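(* Let $G$ be a connected, locally finite, quasi-transitive graph, and let $r>0$ be an integer. Then the $r$-local cover $G_r$ of $G$ is accessible.
   Context: A graph is quasi-transitive if its automorphism group has finitely many vertex orbits. Graphs may have loops and parallel edges and are viewed as 1-complexes; a cycle may be a loop or a pair of parallel edges; a closed walk once around a cycle $O$ traverses every edge of $O$ exactly once. $\pi_1^r(G,x_0)$ is the subgroup of $\pi_1(G,x_0)$ generated by the classes of closed walks $W_0QW_0^-$, $W_0$ a walk from $x_0$ to a vertex $y$, $Q$ a closed walk at $y$ once around a cycle of length at most $r$, $W_0^-$ the reverse of $W_0$. The $r$-local covering $p_r:G_r\to G$ is the connected normal covering with characteristic subgroup $\pi_1^r(G,x_0)$. A separation $\{A,B\}$ of a graph: $A\cup B$ is the vertex set and there is no edge between $A\setminus B$ and $B\setminus A$; its order is $|A\cap B|$. A finite-order separation distinguishes two ends if rays of one end have tails in $G[A]$ and rays of the other in $G[B]$. A graph is accessible if there is $K\in\mathbb{N}$ such that every two of its ends are distinguished by a separation of order at most $K$. *)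

theory Defs
  imports Main
begin

text \<open>A (multi)graph is given by a vertex set V, an edge set E and two endpoint maps
  s t (an arbitrary orientation of each edge).  Loops (s e = t e) and parallel edges
  are allowed.\<close>

definition wf_graph :: "'v set \<Rightarrow> 'e set \<Rightarrow> ('e \<Rightarrow> 'v) \<Rightarrow> ('e \<Rightarrow> 'v) \<Rightarrow> bool" where
  "wf_graph V E s t \<longleftrightarrow> (\<forall>e\<in>E. s e \<in> V \<and> t e \<in> V)"

definition adj :: "'v set \<Rightarrow> 'e set \<Rightarrow> ('e \<Rightarrow> 'v) \<Rightarrow> ('e \<Rightarrow> 'v) \<Rightarrow> 'v \<Rightarrow> 'v \<Rightarrow> bool" where
  "adj V E s t u v \<longleftrightarrow> u \<in> V \<and> v \<in> V \<and> (\<exists>e\<in>E. (s e = u \<and> t e = v) \<or> (s e = v \<and> t e = u))"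

definition reach_avoid :: "'v set \<Rightarrow> 'e set \<Rightarrow> ('e \<Rightarrow> 'v) \<Rightarrow> ('e \<Rightarrow> 'v) \<Rightarrow> 'v set \<Rightarrow> 'v \<Rightarrow> 'v \<Rightarrow> bool" where
  "reach_avoid V E s t S u v \<longleftrightarrow> u \<in> V - S \<and>
     (\<lambda>a b. a \<in> V - S \<and> b \<in> V - S \<and> adj V E s t a b)\<^sup>*\<^sup>* u v"

definition connected_graph :: "'v set \<Rightarrow> 'e set \<Rightarrow> ('e \<Rightarrow> 'v) \<Rightarrow> ('e \<Rightarrow> 'v) \<Rightarrow> bool" where
  "connected_graph V E s t \<longleftrightarrow> V \<noteq> {} \<and> (\<forall>u\<in>V. \<forall>v\<in>V. reach_avoid V E s t {} u v)"

definition locally_finite :: "'v set \<Rightarrow> 'e set \<Rightarrow> ('e \<Rightarrow> 'v) \<Rightarrow> ('e \<Rightarrow> 'v) \<Rightarrow> bool" where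
  "locally_finite V E s t \<longleftrightarrow> (\<forall>v\<in>V. finite {e\<in>E. s e = v \<or> t e = v})"

definition is_aut :: "'v set \<Rightarrow> 'e set \<Rightarrow> ('e \<Rightarrow> 'v) \<Rightarrow> ('e \<Rightarrow> 'v) \<Rightarrow> ('v \<Rightarrow> 'v) \<Rightarrow> ('e \<Rightarrow> 'e) \<Rightarrow> bool" where
  "is_aut V E s t \<phi> \<psi> \<longleftrightarrow> bij_betw \<phi> V V \<and> bij_betw \<psi> E E \<and>
     (\<forall>e\<in>E. {s (\<psi> e), t (\<psi> e)} = {\<phi> (s e), \<phi> (t e)})"

definition aut_orbit :: "'v set \<Rightarrow> 'e set \<Rightarrow> ('e \<Rightarrow> 'v) \<Rightarrow> ('e \<Rightarrow> 'v) \<Rightarrow> 'v \<Rightarrow> 'v set" where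
  "aut_orbit V E s t x = {\<phi> x | \<phi>. \<exists>\<psi>. is_aut V E s t \<phi> \<psi>}"

definition quasi_transitive :: "'v set \<Rightarrow> 'e set \<Rightarrow> ('e \<Rightarrow> 'v) \<Rightarrow> ('e \<Rightarrow> 'v) \<Rightarrow> bool" where
  "quasi_transitive V E s t \<longleftrightarrow> finite (aut_orbit V E s t ` V)"

definition is_ray :: "'v set \<Rightarrow> 'e set \<Rightarrow> ('e \<Rightarrow> 'v) \<Rightarrow> ('e \<Rightarrow> 'v) \<Rightarrow> (nat \<Rightarrow> 'v) \<Rightarrow> bool" where
  "is_ray V E s t R \<longleftrightarrow> inj R \<and> (\<forall>n. R n \<in> V) \<and> (\<forall>n. adj V E s t (R n) (R (Suc n)))"

definition ray_equiv :: "'v set \<Rightarrow> 'e set \<Rightarrow> ('e \<Rightarrow> 'v) \<Rightarrow> ('e \<Rightarrow> 'v) \<Rightarrow> (nat \<Rightarrow> 'v) \<Rightarrow> (nat \<Rightarrow> 'v) \<Rightarrow> bool" where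
  "ray_equiv V E s t R1 R2 \<longleftrightarrow> (\<forall>S. finite S \<longrightarrow>
     (\<exists>n m. (\<forall>k\<ge>n. R1 k \<notin> S) \<and> (\<forall>k\<ge>m. R2 k \<notin> S) \<and> reach_avoid V E s t S (R1 n) (R2 m)))"

definition graph_ends :: "'v set \<Rightarrow> 'e set \<Rightarrow> ('e \<Rightarrow> 'v) \<Rightarrow> ('e \<Rightarrow> 'v) \<Rightarrow> (nat \<Rightarrow> 'v) set set" where
  "graph_ends V E s t = {{R'. is_ray V E s t R' \<and> ray_equiv V E s t R R'} | R. is_ray V E s t R}"

definition is_separation :: "'v set \<Rightarrow> 'e set \<Rightarrow> ('e \<Rightarrow> 'v) \<Rightarrow> ('e \<Rightarrow> 'v) \<Rightarrow> 'v set \<Rightarrow> 'v set \<Rightarrow> bool" where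
  "is_separation V E s t A B \<longleftrightarrow> A \<union> B = V \<and>
     (\<forall>e\<in>E. \<not> (s e \<in> A - B \<and> t e \<in> B - A) \<and> \<not> (s e \<in> B - A \<and> t e \<in> A - B))"

definition has_tail_in :: "(nat \<Rightarrow> 'v) \<Rightarrow> 'v set \<Rightarrow> bool" where
  "has_tail_in R A \<longleftrightarrow> (\<exists>n. \<forall>k\<ge>n. R k \<in> A)"

definition distinguishes :: "'v set \<Rightarrow> 'e set \<Rightarrow> ('e \<Rightarrow> 'v) \<Rightarrow> ('e \<Rightarrow> 'v) \<Rightarrow> 'v set \<Rightarrow> 'v set \<Rightarrow> (nat \<Rightarrow> 'v) set \<Rightarrow> (nat \<Rightarrow> 'v) set \<Rightarrow> bool" where
  "distinguishes V E s t A B \<omega>1 \<omega>2 \<longleftrightarrow> is_separation V E s t A B \<and> finite (A \<inter> B) \<and>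
     (\<forall>R\<in>\<omega>1. has_tail_in R A) \<and> (\<forall>R\<in>\<omega>2. has_tail_in R B)"

definition accessible :: "'v set \<Rightarrow> 'e set \<Rightarrow> ('e \<Rightarrow> 'v) \<Rightarrow> ('e \<Rightarrow> 'v) \<Rightarrow> bool" where
  "accessible V E s t \<longleftrightarrow> (\<exists>K::nat. \<forall>\<omega>1\<in>graph_ends V E s t. \<forall>\<omega>2\<in>graph_ends V E s t.
     \<omega>1 \<noteq> \<omega>2 \<longrightarrow> (\<exists>A B. distinguishes V E s t A B \<omega>1 \<omega>2 \<and> card (A \<inter> B) \<le> K))"

text \<open>A dart (e, True) traverses e from s e to t e, (e, False) from t e to s e.\<close>
type_synonym 'e dart = "'e \<times> bool"

definition dstart :: "('e \<Rightarrow> 'v) \<Rightarrow> ('e \<Rightarrow> 'v) \<Rightarrow> 'e dart \<Rightarrow> 'v" where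
  "dstart s t d = (if snd d then s (fst d) else t (fst d))"

definition dend :: "('e \<Rightarrow> 'v) \<Rightarrow> ('e \<Rightarrow> 'v) \<Rightarrow> 'e dart \<Rightarrow> 'v" where
  "dend s t d = (if snd d then t (fst d) else s (fst d))"

definition drev :: "'e dart \<Rightarrow> 'e dart" where
  "drev d = (fst d, \<not> snd d)"

fun is_walk :: "'v set \<Rightarrow> 'e set \<Rightarrow> ('e \<Rightarrow> 'v) \<Rightarrow> ('e \<Rightarrow> 'v) \<Rightarrow> 'v \<Rightarrow> 'e dart list \<Rightarrow> 'v \<Rightarrow> bool" where
  "is_walk V E s t x [] y \<longleftrightarrow> x \<in> V \<and> x = y"
| "is_walk V E s t x (d # ds) y \<longleftrightarrow> x \<in> V \<and> fst d \<in> E \<and> dstart s t d = x \<and> is_walk V E s t (dend s t d) ds y"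

definition walk_rev :: "'e dart list \<Rightarrow> 'e dart list" where
  "walk_rev ds = rev (map drev ds)"

text \<open>A closed walk at y once around a cycle (a loop, a pair of parallel edges,
  or an ordinary cycle): it uses distinct edges and visits distinct vertices.\<close>
definition cycle_walk :: "'v set \<Rightarrow> 'e set \<Rightarrow> ('e \<Rightarrow> 'v) \<Rightarrow> ('e \<Rightarrow> 'v) \<Rightarrow> 'v \<Rightarrow> 'e dart list \<Rightarrow> bool" where
  "cycle_walk V E s t y Q \<longleftrightarrow> Q \<noteq> [] \<and> is_walk V E s t y Q y \<and>
     distinct (map fst Q) \<and> distinct (map (dstart s t) Q)"

definition backtrack_step :: "'e dart list \<Rightarrow> 'e dart list \<Rightarrow> bool" where
  "backtrack_step a b \<longleftrightarrow> (\<exists>p q d. a = p @ [d, drev d] @ q \<and> b = p @ q)"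

definition homotopic :: "'e dart list \<Rightarrow> 'e dart list \<Rightarrow> bool" where
  "homotopic = equivclp backtrack_step"

text \<open>Closed walks at x0 whose homotopy class lies in \<pi>1^r(G,x0), i.e. the subgroup
  generated by the classes of W0 Q W0^- with Q once around a cycle of length \<le> r.\<close>
inductive_set pi1r :: "'v set \<Rightarrow> 'e set \<Rightarrow> ('e \<Rightarrow> 'v) \<Rightarrow> ('e \<Rightarrow> 'v) \<Rightarrow> 'v \<Rightarrow> nat \<Rightarrow> 'e dart list set"
  for V E s t x0 r where
  triv: "x0 \<in> V \<Longrightarrow> [] \<in> pi1r V E s t x0 r"
| gen: "is_walk V E s t x0 W0 y \<Longrightarrow> cycle_walk V E s t y Q \<Longrightarrow> length Q \<le> r \<Longrightarrow>
         W0 @ Q @ walk_rev W0 \<in> pi1r V E s t x0 r"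
| inv: "W \<in> pi1r V E s t x0 r \<Longrightarrow> walk_rev W \<in> pi1r V E s t x0 r"
| mult: "W \<in> pi1r V E s t x0 r \<Longrightarrow> W' \<in> pi1r V E s t x0 r \<Longrightarrow> W @ W' \<in> pi1r V E s t x0 r"
| htpy: "W \<in> pi1r V E s t x0 r \<Longrightarrow> is_walk V E s t x0 W' x0 \<Longrightarrow> homotopic W W' \<Longrightarrow>
         W' \<in> pi1r V E s t x0 r"

text \<open>The covering with characteristic subgroup \<pi>1^r: vertices are classes of walks
  from x0, where W ~ W' iff they end at the same vertex and [W W'^-] \<in> \<pi>1^r.\<close>
definition cover_class :: "'v set \<Rightarrow> 'e set \<Rightarrow> ('e \<Rightarrow> 'v) \<Rightarrow> ('e \<Rightarrow> 'v) \<Rightarrow> 'v \<Rightarrow> nat \<Rightarrow> 'e dart list \<Rightarrow> 'e dart list set" where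
  "cover_class V E s t x0 r W = {W'. \<exists>y. is_walk V E s t x0 W y \<and> is_walk V E s t x0 W' y \<and>
      W @ walk_rev W' \<in> pi1r V E s t x0 r}"

definition cover_V :: "'v set \<Rightarrow> 'e set \<Rightarrow> ('e \<Rightarrow> 'v) \<Rightarrow> ('e \<Rightarrow> 'v) \<Rightarrow> 'v \<Rightarrow> nat \<Rightarrow> 'e dart list set set" where
  "cover_V V E s t x0 r = {cover_class V E s t x0 r W | W. \<exists>y. is_walk V E s t x0 W y}"

text \<open>Edges of the cover: the lift of edge e starting at the class X (whose walks end at s e).\<close>
definition cover_E :: "'v set \<Rightarrow> 'e set \<Rightarrow> ('e \<Rightarrow> 'v) \<Rightarrow> ('e \<Rightarrow> 'v) \<Rightarrow> 'v \<Rightarrow> nat \<Rightarrow> ('e dart list set \<times> 'e) set" where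
  "cover_E V E s t x0 r = {(X, e). X \<in> cover_V V E s t x0 r \<and> e \<in> E \<and> (\<exists>W\<in>X. is_walk V E s t x0 W (s e))}"

definition cover_src :: "('e dart list set \<times> 'e) \<Rightarrow> 'e dart list set" where
  "cover_src xe = fst xe"

definition cover_tgt :: "'v set \<Rightarrow> 'e set \<Rightarrow> ('e \<Rightarrow> 'v) \<Rightarrow> ('e \<Rightarrow> 'v) \<Rightarrow> 'v \<Rightarrow> nat \<Rightarrow> ('e dart list set \<times> 'e) \<Rightarrow> 'e dart list set" where
  "cover_tgt V E s t x0 r xe = cover_class V E s t x0 r ((SOME W. W \<in> fst xe) @ [(snd xe, True)])"

end

(* Every end-separating cut of minimum order is tight: both sides are connected. Since the cycles of
   the cover are generated by short ones, a nonempty proper subset of the edge boundary of a tight cut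
   always shares a short closed walk with its complement in the boundary. Submodularity lets one uncross
   minimum cuts, which yields, for each n, a nested family, invariant under all automorphisms, that
   contains a minimum cut of every order below n that occurs at all. Each member A of a nested family of
   tight cuts is the largest member with its trace on some short closed walk: otherwise the next larger
   member agreeing with A somewhere would, by connectedness along short closed walks, have the same
   boundary. Up to automorphisms there are finitely many short closed walks, hence finitely many traces,
   so the number of orders that occur is bounded independently of n. *)

theory Submission
  imports Defs Complex_Main
begin

section \<open>Edge cuts in graphs\<close>

text \<open>What gets bounded is how many orders occur, not the orders themselves; a finite set of
  naturals has a maximum, and this is the accessibility constant. Local finiteness alone would not
  do: the ball known to contain the boundary of a tight cut has a radius growing with its order,
  whereas a trace lives on a walk of fixed length. Generation by short cycles enters only mod 2: a
  symmetric edge set crossed evenly by every short closed walk is a cut. This says that the first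
  cohomology with two-element coefficients vanishes once short closed walks are filled in. Cuts are
  sets of vertices measured by their edge boundary, since this count is submodular and the oriented
  boundary determines a tight cut. The outer ends of the boundary edges yield a vertex separator of
  no larger order. Invariance of the nested family serves to move a cut together with its short walk
  into one finite ball without leaving the family. Enough automorphisms of the cover exist because
  those of the base graph lift: they permute the cycles of length at most \<open>r\<close>, hence
  respect the defining subgroup up to a change of base point.\<close>

fun crossing_parity :: "('a \<times> 'a) set \<Rightarrow> 'a list \<Rightarrow> bool" where
  "crossing_parity P (x # y # zs) = (((x, y) \<in> P) \<noteq> crossing_parity P (y # zs))"
| "crossing_parity P _ = False"

text \<open>Telescoping mod 2: every crossing switches between \<open>S\<close> and its complement,
  so only the two ends of the walk matter. In particular a closed walk crosses a cut evenly.\<close>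

lemma crossing_parity_coboundary:
  assumes "vs \<noteq> []" "\<And>u v. (u, v) \<in> set (zip vs (tl vs)) \<Longrightarrow> (u, v) \<in> P \<longleftrightarrow> (u \<in> S) \<noteq> (v \<in> S)"
  shows "crossing_parity P vs \<longleftrightarrow> (hd vs \<in> S) \<noteq> (last vs \<in> S)"
  using assms by (induction P vs rule: crossing_parity.induct) auto

lemma crossing_parity_False:
  assumes "\<And>u v. (u, v) \<in> set (zip vs (tl vs)) \<Longrightarrow> (u, v) \<notin> P"
  shows "\<not> crossing_parity P vs"
  using assms by (induction P vs rule: crossing_parity.induct) auto

text \<open>One of the four corners of the two cuts is empty; for subsets of \<open>V\<close> the
  relation is therefore insensitive to replacing either set by its complement.\<close>

definition nested_in :: "'a set \<Rightarrow> 'a set \<Rightarrow> 'a set \<Rightarrow> bool" where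
  "nested_in V A B \<longleftrightarrow> A \<subseteq> B \<or> B \<subseteq> A \<or> A \<inter> B = {} \<or> A \<union> B = V"

lemma nested_in_sym: "nested_in V A B \<Longrightarrow> nested_in V B A"
  unfolding nested_in_def by blast

lemma nested_in_compl:
  assumes "D \<subseteq> V" "B \<subseteq> V" shows "nested_in V D (V - B) \<longleftrightarrow> nested_in V D B"
  using assms unfolding nested_in_def by blast

text \<open>Crossing of \<open>A\<close> and \<open>B\<close> supplies a point in each of the four
  corners. These points refute incompatible positions of \<open>D\<close>, such as
  \<open>B \<subseteq> D \<subseteq> A\<close>; every other position passes directly to both
  corners.\<close>

lemma nested_in_corners:
  assumes "A \<subseteq> V" "B \<subseteq> V" "D \<subseteq> V" "\<not> nested_in V A B" "nested_in V D A" "nested_in V D B"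
  shows "nested_in V D (A \<inter> B)" "nested_in V D (A \<union> B)"
proof -
  have AB: "\<not> A \<subseteq> B" "\<not> B \<subseteq> A" "A \<inter> B \<noteq> {}" "A \<union> B \<noteq> V"
    using assms(4) unfolding nested_in_def by auto
  obtain p q r z where pq: "p \<in> A - B" "q \<in> B - A" "r \<in> A \<inter> B" "z \<in> V - (A \<union> B)"
    using AB assms(1,2) by blast
  show "nested_in V D (A \<inter> B)"
    using assms(5,6) unfolding nested_in_def by (elim disjE) (use assms(1-3) pq in auto)
  show "nested_in V D (A \<union> B)"
    using assms(5,6) unfolding nested_in_def by (elim disjE) (use assms(1-3) pq in auto)
qed

text \<open>Shrinking \<open>A\<close> preserves \<open>A \<subseteq> D\<close> and disjointness,
  enlarging it preserves \<open>D \<subseteq> A\<close> and covering. This gives the intersection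
  half of the crossing count in \<open>nested_family_step\<close>.\<close>

lemma nested_in_some_corner:
  assumes "nested_in V D A" "A \<subseteq> V" "B \<subseteq> V" "D \<subseteq> V"
  shows "nested_in V D (A \<inter> B) \<or> nested_in V D (A \<union> B)"
  using assms unfolding nested_in_def by blast

lemma nested_in_image:
  assumes "bij_betw g V V" "A \<subseteq> V" "B \<subseteq> V"
  shows "nested_in V (g ` A) (g ` B) \<longleftrightarrow> nested_in V A B"
proof -
  have inj: "inj_on g V" and V: "g ` V = V" using assms(1) by (auto simp: bij_betw_def)
  have sub: "g ` X \<subseteq> g ` Y \<longleftrightarrow> X \<subseteq> Y" if "X \<subseteq> V" "Y \<subseteq> V" for X Y
    using inj_on_image_mem_iff[OF inj _ that(2)] that(1) unfolding image_subset_iff by blast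
  have "g ` A \<subseteq> g ` B \<longleftrightarrow> A \<subseteq> B" "g ` B \<subseteq> g ` A \<longleftrightarrow> B \<subseteq> A"
    using sub assms by auto
  moreover have "g ` A \<inter> g ` B = {} \<longleftrightarrow> A \<inter> B = {}"
    using inj_on_image_Int[OF inj assms(2,3)] by (metis image_is_empty)
  moreover have "g ` A \<union> g ` B = V \<longleftrightarrow> A \<union> B = V"
    using inj_on_image_eq_iff[OF inj, of "A \<union> B" V] assms V by (auto simp: image_Un)
  ultimately show ?thesis unfolding nested_in_def by simp
qed

section \<open>Edge boundaries, separation of ends, and submodularity\<close>

locale simple_graph =
  fixes V :: "'a set" and nb :: "'a \<Rightarrow> 'a \<Rightarrow> bool"
  assumes nb_in: "nb u v \<Longrightarrow> u \<in> V"
    and nb_sym: "nb u v \<Longrightarrow> nb v u"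
begin

lemma nb_in2: "nb u v \<Longrightarrow> v \<in> V" using nb_in nb_sym by blast

text \<open>Edges are oriented outwards, so the boundary records which side is \<open>A\<close>. As
  pairs of vertices, parallel edges count once and loops never.\<close>

definition bdry :: "'a set \<Rightarrow> ('a \<times> 'a) set" where
  "bdry A = {(u, v). nb u v \<and> u \<in> A \<and> v \<notin> A}"

definition conn :: "'a set \<Rightarrow> bool" where
  "conn A \<longleftrightarrow> (\<forall>S\<subseteq>A. S \<noteq> {} \<longrightarrow> S \<noteq> A \<longrightarrow> (\<exists>u\<in>S. \<exists>v\<in>A - S. nb u v))"

definition tight :: "'a set \<Rightarrow> bool" where
  "tight A \<longleftrightarrow> A \<subseteq> V \<and> A \<noteq> {} \<and> A \<noteq> V \<and> finite (bdry A) \<and> conn A \<and> conn (V - A)"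

text \<open>The first vertex is repeated at the end, so \<open>Suc m\<close> entries make
  \<open>m\<close> steps. Vertices may recur: walks \<open>[a, b, a]\<close> along an edge and back
  are needed later.\<close>

definition short_closed :: "nat \<Rightarrow> 'a list \<Rightarrow> bool" where
  "short_closed m vs \<longleftrightarrow> vs \<noteq> [] \<and> successively nb vs \<and> hd vs = last vs \<and> length vs \<le> Suc m"

definition aut :: "('a \<Rightarrow> 'a) \<Rightarrow> bool" where
  "aut g \<longleftrightarrow> bij_betw g V V \<and> (\<forall>u\<in>V. \<forall>v\<in>V. nb (g u) (g v) \<longleftrightarrow> nb u v)"

text \<open>Of a ray, only the side of each finite cut on which it eventually stays matters; this notion is
  visibly preserved by automorphisms.\<close>
definition endlike :: "(nat \<Rightarrow> 'a) \<Rightarrow> bool" where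
  "endlike \<rho> \<longleftrightarrow> range \<rho> \<subseteq> V \<and> (\<forall>A\<subseteq>V. finite (bdry A) \<longrightarrow>
     (\<forall>\<^sub>F k in sequentially. \<rho> k \<in> A) \<or> (\<forall>\<^sub>F k in sequentially. \<rho> k \<in> V - A))"

definition separates :: "'a set \<Rightarrow> (nat \<Rightarrow> 'a) \<Rightarrow> (nat \<Rightarrow> 'a) \<Rightarrow> bool" where
  "separates A \<rho> \<sigma> \<longleftrightarrow> A \<subseteq> V \<and> finite (bdry A) \<and>
     (\<forall>\<^sub>F k in sequentially. \<rho> k \<in> A) \<and> (\<forall>\<^sub>F k in sequentially. \<sigma> k \<in> V - A)"

definition edge_conn_ge :: "nat \<Rightarrow> (nat \<Rightarrow> 'a) \<Rightarrow> (nat \<Rightarrow> 'a) \<Rightarrow> bool" where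
  "edge_conn_ge k \<rho> \<sigma> \<longleftrightarrow> endlike \<rho> \<and> endlike \<sigma> \<and> (\<forall>B. separates B \<rho> \<sigma> \<longrightarrow> k \<le> card (bdry B))"

text \<open>Minimality refers to a single pair of ends, which may differ from cut to cut;
  \<open>uncross\<close> therefore has to locate four ends.\<close>

definition optimal :: "nat \<Rightarrow> 'a set \<Rightarrow> bool" where
  "optimal k A \<longleftrightarrow> card (bdry A) = k \<and> (\<exists>\<rho> \<sigma>. separates A \<rho> \<sigma> \<and> edge_conn_ge k \<rho> \<sigma>)"

lemma bdry_compl: "A \<subseteq> V \<Longrightarrow> bdry (V - A) = prod.swap ` bdry A"
  by (auto simp: bdry_def image_iff nb_in nb_in2 intro: nb_sym)

lemma finite_bdry_compl: "A \<subseteq> V \<Longrightarrow> finite (bdry A) \<Longrightarrow> finite (bdry (V - A))"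
  by (simp add: bdry_compl)

lemma card_bdry_compl: "A \<subseteq> V \<Longrightarrow> card (bdry (V - A)) = card (bdry A)"
  by (simp add: bdry_compl card_image)

lemma separates_compl: "separates A \<rho> \<sigma> \<Longrightarrow> separates (V - A) \<sigma> \<rho>"
  unfolding separates_def
  by (auto simp: finite_bdry_compl elim: eventually_mono)

lemma edge_conn_ge_sym: "edge_conn_ge k \<rho> \<sigma> \<Longrightarrow> edge_conn_ge k \<sigma> \<rho>"
  unfolding edge_conn_ge_def using separates_compl card_bdry_compl separates_def by metis

lemma optimal_subset: "optimal k A \<Longrightarrow> A \<subseteq> V"
  and optimal_finite: "optimal k A \<Longrightarrow> finite (bdry A)"
  and optimal_card: "optimal k A \<Longrightarrow> card (bdry A) = k"
  by (auto simp: optimal_def separates_def)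

lemma optimal_compl: "optimal k A \<Longrightarrow> optimal k (V - A)"
  using optimal_subset[of k A] unfolding optimal_def
  using separates_compl edge_conn_ge_sym card_bdry_compl by metis

lemma bdry_Int_Un: 
  "bdry (A \<inter> B) \<union> bdry (A \<union> B) \<subseteq> bdry A \<union> bdry B"
  "bdry (A \<inter> B) \<inter> bdry (A \<union> B) \<subseteq> bdry A \<inter> bdry B"
  by (auto simp: bdry_def)

text \<open>Union and intersection of the corner boundaries lie in those of the given boundaries, so
  inclusion-exclusion applies. The edges lost are those between \<open>A - B\<close> and
  \<open>B - A\<close>.\<close>

lemma submodular:
  assumes "finite (bdry A)" "finite (bdry B)"
  shows "card (bdry (A \<inter> B)) + card (bdry (A \<union> B)) \<le> card (bdry A) + card (bdry B)"
proof -
  have f: "finite (bdry (A \<inter> B))" "finite (bdry (A \<union> B))"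
    using bdry_Int_Un(1)[of A B] assms by (meson finite_UnI finite_subset le_supE)+
  have "card (bdry (A \<inter> B) \<union> bdry (A \<union> B)) \<le> card (bdry A \<union> bdry B)"
    "card (bdry (A \<inter> B) \<inter> bdry (A \<union> B)) \<le> card (bdry A \<inter> bdry B)"
    using bdry_Int_Un[of A B] assms by (auto intro: card_mono)
  then show ?thesis using card_Un_Int[OF f] card_Un_Int[OF assms] by linarith
qed

text \<open>Each corner still separates a pair that needs \<open>k\<close> or \<open>l\<close> edges
  respectively, so neither boundary can be smaller; submodularity leaves no room for a larger
  one.\<close>

lemma uncross_aux:
  assumes A: "A \<subseteq> V" "finite (bdry A)" and B: "B \<subseteq> V" "finite (bdry B)"
    and kl: "card (bdry A) + card (bdry B) \<le> k + l"
    and k: "edge_conn_ge k \<rho> \<rho>'" "\<forall>\<^sub>F n in sequentially. \<rho> n \<in> A \<inter> B"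
      "\<forall>\<^sub>F n in sequentially. \<rho>' n \<in> V - A \<inter> B"
    and l: "edge_conn_ge l \<sigma> \<sigma>'" "\<forall>\<^sub>F n in sequentially. \<sigma> n \<in> V - (A \<union> B)"
      "\<forall>\<^sub>F n in sequentially. \<sigma>' n \<in> A \<union> B"
  shows "optimal k (A \<inter> B)" "optimal l (A \<union> B)"
proof -
  have f: "finite (bdry (A \<inter> B))" "finite (bdry (A \<union> B))"
    using bdry_Int_Un(1)[of A B] A B by (meson finite_UnI finite_subset le_supE)+
  have s: "separates (A \<inter> B) \<rho> \<rho>'" "separates (A \<union> B) \<sigma>' \<sigma>"
    using f A B k l by (auto simp: separates_def)
  have "k \<le> card (bdry (A \<inter> B))" "l \<le> card (bdry (A \<union> B))"
    using s k(1) edge_conn_ge_sym[OF l(1)] by (auto simp: edge_conn_ge_def)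
  then have "card (bdry (A \<inter> B)) = k" "card (bdry (A \<union> B)) = l"
    using submodular[OF A(2) B(2)] kl by linarith+
  then show "optimal k (A \<inter> B)" "optimal l (A \<union> B)"
    using s k(1) edge_conn_ge_sym[OF l(1)] unfolding optimal_def by auto
qed

text \<open>Sides are chosen so that two opposite corners each contain an end of a suitable pair.
  The hypothesis \<open>l \<le> k\<close> matters when \<open>B\<close> also separates the pair of
  \<open>A\<close>: this forces \<open>k \<le> l\<close>, hence equality, and that one pair serves
  both corners.\<close>

lemma uncross:
  assumes A: "optimal k A" and B: "optimal l B" and kl: "l \<le> k"
  shows "\<exists>A'\<in>{A, V - A}. \<exists>B'\<in>{B, V - B}. optimal k (A' \<inter> B') \<and> optimal l (A' \<union> B')"
proof -
  have AV: "A \<subseteq> V" "finite (bdry A)" "card (bdry A) = k"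
    and BV: "B \<subseteq> V" "finite (bdry B)" "card (bdry B) = l"
    using A B optimal_subset optimal_finite optimal_card by auto
  have cA: "A' \<subseteq> V" "finite (bdry A')" "card (bdry A') = k" if "A' \<in> {A, V - A}" for A'
    using that AV finite_bdry_compl card_bdry_compl by auto
  have cB: "B' \<subseteq> V" "finite (bdry B')" "card (bdry B') = l" if "B' \<in> {B, V - B}" for B'
    using that BV finite_bdry_compl card_bdry_compl by auto
  obtain \<rho> \<rho>' where r: "separates A \<rho> \<rho>'" "edge_conn_ge k \<rho> \<rho>'" using A optimal_def by auto
  obtain \<sigma> \<sigma>' where s: "separates B \<sigma> \<sigma>'" "edge_conn_ge l \<sigma> \<sigma>'" using B optimal_def by auto
  have ends: "endlike \<rho>" "endlike \<rho>'" "endlike \<sigma>" "endlike \<sigma>'" 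
    using r s unfolding edge_conn_ge_def by auto
  define ev where "ev \<rho> A \<longleftrightarrow> (\<forall>\<^sub>F k in sequentially. \<rho> k \<in> A)" for \<rho> :: "nat \<Rightarrow> 'a" and A
  have evD: "ev \<rho> A \<or> ev \<rho> (V - A)" if "endlike \<rho>" "A \<subseteq> V" "finite (bdry A)" for \<rho> A
    using that unfolding endlike_def ev_def by auto
  have evI: "ev \<rho> (A \<inter> B)" if "ev \<rho> A" "ev \<rho> B" for \<rho> A B 
    using that unfolding ev_def by (auto intro: eventually_elim2)
  have evm: "ev \<rho> B" if "ev \<rho> A" "A \<subseteq> B" for \<rho> A B 
    using that unfolding ev_def by (auto elim: eventually_mono)
  have rA: "ev \<rho> A" "ev \<rho>' (V - A)" and sB: "ev \<sigma> B" "ev \<sigma>' (V - B)"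
    using r s unfolding separates_def ev_def by auto
  have *: ?thesis if "A' \<in> {A, V - A}" "B' \<in> {B, V - B}" "edge_conn_ge k \<tau> \<tau>'"
    "ev \<tau> A'" "ev \<tau> B'" "ev \<tau>' (V - A')" "edge_conn_ge l \<upsilon> \<upsilon>'" "ev \<upsilon> (V - A')" "ev \<upsilon> (V - B')" "ev \<upsilon>' (A' \<union> B')"
  for A' B' \<tau> \<tau>' \<upsilon> \<upsilon>'
  proof -
    have "optimal k (A' \<inter> B') \<and> optimal l (A' \<union> B')"
      using uncross_aux[OF cA(1,2)[OF that(1)] cB(1,2)[OF that(2)], of k l \<tau> \<tau>' \<upsilon> \<upsilon>']
        evI[of \<tau> A' B'] evm[of \<tau>' "V - A'" "V - A' \<inter> B'"] evI[of \<upsilon> "V - A'" "V - B'"] that cA(3) cB(3)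
      unfolding ev_def[symmetric] by (simp add: Diff_Un Diff_Int)
    then show ?thesis using that by blast
  qed
  show ?thesis
  proof (cases "\<exists>B'\<in>{B, V - B}. ev \<rho> B' \<and> ev \<rho>' (V - B')")
    case True
    then obtain B' where B': "B' \<in> {B, V - B}" "ev \<rho> B'" "ev \<rho>' (V - B')" by blast
    have "separates B' \<rho> \<rho>'"
      using B'(2,3) cB(1,2)[OF B'(1)] unfolding separates_def ev_def by simp
    then have "k \<le> l" using r(2) cB(3)[OF B'(1)] unfolding edge_conn_ge_def by metis
    then have "k = l" using kl by simp
    then show ?thesis
      using *[OF _ B'(1) r(2) rA(1) B'(2) rA(2) _ rA(2) B'(3) evm[OF rA(1)]] edge_conn_ge_sym[OF r(2)]
      by simp
  next
    case False
    have "V - (V - B) = B" using BV by auto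
    \<comment> \<open>Now both ends belonging to \<open>A\<close> lie on one side \<open>B'\<close>
      of \<open>B\<close>. The pair of \<open>B\<close> has an end \<open>\<upsilon>\<close> on the
      other side; if \<open>A'\<close> is the side of \<open>A\<close> avoiding
      \<open>\<upsilon>\<close>, one of \<open>\<rho>\<close>, \<open>\<rho>'\<close> lies in
      \<open>A' \<inter> B'\<close>, and \<open>\<upsilon>\<close> lies in the opposite
      corner.\<close>
    then obtain B' where B': "B' \<in> {B, V - B}" "ev \<rho> B'" "ev \<rho>' B'"
      using False evD[OF ends(1) BV(1,2)] evD[OF ends(2) BV(1,2)] by (metis insertCI)
    obtain \<upsilon> \<upsilon>' where u: "edge_conn_ge l \<upsilon> \<upsilon>'" "ev \<upsilon> (V - B')" "ev \<upsilon>' B'" "endlike \<upsilon>"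
    proof (cases "B' = B")
      case True
      then show ?thesis using that[OF edge_conn_ge_sym[OF s(2)]] sB ends by simp
    next
      case False
      then have "B' = V - B" using B'(1) by simp
      then show ?thesis using that[OF s(2)] sB ends \<open>V - (V - B) = B\<close> by simp
    qed
    have u': "ev \<upsilon>' (A \<union> B')" "ev \<upsilon>' ((V - A) \<union> B')" using evm[OF u(3)] by simp_all
    have VA: "V - (V - A) = A" using AV by auto
    show ?thesis using evD[OF u(4) AV(1,2)]
    proof
      assume "ev \<upsilon> A"
      then show ?thesis 
        using *[OF _ B'(1) edge_conn_ge_sym[OF r(2)] rA(2) B'(3) _ u(1) _ u(2) u'(2)] rA(1) VA by simp
    next
      assume "ev \<upsilon> (V - A)"
      then show ?thesis 
        using *[OF _ B'(1) r(2) rA(1) B'(2) rA(2) u(1) _ u(2) u'(1)] by simp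
    qed
  qed
qed

end

section \<open>Tight cuts and short closed walks\<close>

text \<open>\<open>coboundary\<close> is the mod 2 form of "short closed walks generate all closed
  walks". \<open>R\<close> is a finite set meeting every orbit, that is, quasi-transitivity.\<close>

locale short_cycle_graph = simple_graph +
  fixes m :: nat and R :: "'a set"
  assumes connected: "conn V"
    and locally_fin: "finite {v. nb u v}"
    and m_ge: "2 \<le> m"
    and coboundary: "sym P \<Longrightarrow> (\<And>vs. short_closed m vs \<Longrightarrow> \<not> crossing_parity P vs) \<Longrightarrow>
      \<exists>S. \<forall>u v. nb u v \<longrightarrow> ((u, v) \<in> P \<longleftrightarrow> (u \<in> S) \<noteq> (v \<in> S))"
    and finite_R: "finite R"
    and R_meets: "x \<in> V \<Longrightarrow> \<exists>g. aut g \<and> g x \<in> R"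
begin

lemma connD:
  assumes "conn D" "x \<in> D" "x \<in> A" "y \<in> D" "y \<notin> A"
  shows "\<exists>u\<in>D \<inter> A. \<exists>v\<in>D - A. nb u v"
proof -
  have "\<exists>u\<in>D \<inter> A. \<exists>v\<in>D - D \<inter> A. nb u v"
    using assms(1)[unfolded conn_def, rule_format, of "D \<inter> A"] assms by blast
  then show ?thesis by blast
qed

lemma bdry_nonempty: "A \<subseteq> V \<Longrightarrow> A \<noteq> {} \<Longrightarrow> A \<noteq> V \<Longrightarrow> bdry A \<noteq> {}"
  using connected unfolding conn_def bdry_def by blast

text \<open>A step inside \<open>D\<close> that leaves \<open>A\<close> would be an edge of
  \<open>bdry A\<close>, hence of \<open>bdry D\<close>; but its second end is still in
  \<open>D\<close>.\<close>

lemma subset_of_bdry_subset: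
  assumes "conn D" "x \<in> D" "x \<in> A" "bdry A \<subseteq> bdry D"
  shows "D \<subseteq> A"
proof
  fix y assume "y \<in> D"
  then show "y \<in> A" using connD[OF assms(1-3), of y] assms(4) by (fastforce simp: bdry_def)
qed

lemma optimal_nontrivial: "optimal k A \<Longrightarrow> A \<noteq> {} \<and> A \<noteq> V"
  unfolding optimal_def separates_def by auto

text \<open>If \<open>A\<close> fell apart, the part holding the end \<open>\<rho>\<close> would
  still separate and, by minimality, would use all of \<open>bdry A\<close>. The rest would have
  empty boundary, against connectedness of the graph.\<close>

lemma optimal_conn:
  assumes "optimal k A" shows "conn A"
proof (rule ccontr)
  assume "\<not> conn A"
  then obtain S where S: "S \<subseteq> A" "S \<noteq> {}" "S \<noteq> A" "\<And>u v. u \<in> S \<Longrightarrow> v \<in> A - S \<Longrightarrow> \<not> nb u v"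
    unfolding conn_def by blast
  obtain \<rho> \<sigma> where *: "separates A \<rho> \<sigma>" "edge_conn_ge k \<rho> \<sigma>"
    using assms unfolding optimal_def by blast
  have fin: "finite (bdry A)" "card (bdry A) = k" and AV: "A \<subseteq> V"
    using assms by (auto simp: optimal_def separates_def)
  have no: False if T: "T \<subseteq> A" "T \<noteq> {}" "T \<noteq> A" "\<And>u v. u \<in> T \<Longrightarrow> v \<in> A - T \<Longrightarrow> \<not> nb u v"
    and ev: "\<forall>\<^sub>F k in sequentially. \<rho> k \<in> T" for T
  proof -
    have TA: "bdry T \<subseteq> bdry A" using T by (auto simp: bdry_def)
    then have "finite (bdry T)" using fin finite_subset by blast
    moreover have "\<forall>\<^sub>F k in sequentially. \<sigma> k \<in> V - T"
      using *(1) T(1) unfolding separates_def by (auto elim: eventually_mono)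
    ultimately have "separates T \<rho> \<sigma>" using T(1) AV ev unfolding separates_def by auto
    then have "card (bdry A) \<le> card (bdry T)" using *(2) fin unfolding edge_conn_ge_def by auto
    then have eq: "bdry T = bdry A" using TA fin(1) by (metis card_seteq)
    have "bdry (A - T) \<subseteq> bdry A - bdry T" 
      using T(4) nb_sym by (fastforce simp: bdry_def)
    then have "bdry (A - T) = {}" using eq by blast
    then show False using bdry_nonempty[of "A - T"] T(1-3) AV by blast
  qed
  have "endlike \<rho>" using * unfolding edge_conn_ge_def by auto
  moreover have "bdry S \<subseteq> bdry A" using S(1,4) by (auto simp: bdry_def)
  then have "finite (bdry S)" using fin(1) finite_subset by blast
  ultimately have "(\<forall>\<^sub>F k in sequentially. \<rho> k \<in> S) \<or> (\<forall>\<^sub>F k in sequentially. \<rho> k \<in> V - S)"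
    using S(1) AV unfolding endlike_def by blast
  then show False
  proof
    assume "\<forall>\<^sub>F k in sequentially. \<rho> k \<in> S" then show False using no S by blast
  next
    assume "\<forall>\<^sub>F k in sequentially. \<rho> k \<in> V - S"
    moreover have "\<forall>\<^sub>F k in sequentially. \<rho> k \<in> A" using * unfolding separates_def by auto
    ultimately have "\<forall>\<^sub>F k in sequentially. \<rho> k \<in> A - S" by (auto elim: eventually_elim2)
    then show False using no[of "A - S"] S nb_sym by blast
  qed
qed

lemma optimal_tight: "optimal k A \<Longrightarrow> tight A"
  unfolding tight_def using optimal_nontrivial optimal_conn[OF optimal_compl] optimal_conn 
    optimal_finite optimal_subset by blast

lemma tight_bdry_nonempty: "tight A \<Longrightarrow> bdry A \<noteq> {}"
  unfolding tight_def using bdry_nonempty by blast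

lemma successively_zip: "successively nb vs \<Longrightarrow> (u, v) \<in> set (zip vs (tl vs)) \<Longrightarrow> nb u v"
  by (induction nb vs rule: successively.induct) auto

text \<open>Otherwise, along each short closed walk the symmetrised \<open>P\<close> is either
  absent or equal to the coboundary of \<open>A\<close>, hence crossed evenly. So it is the
  coboundary of some \<open>S\<close>; as both sides of \<open>A\<close> are connected and contain
  no edge of \<open>P\<close>, \<open>S\<close> is constant on each, and \<open>P\<close> is all or
  nothing. The walk need only visit both ends of an edge, not traverse it.\<close>

lemma short_connect:
  assumes A: "tight A" and P: "P \<subseteq> bdry A" "P \<noteq> {}" "P \<noteq> bdry A"
  shows "\<exists>vs. short_closed m vs \<and> (\<exists>(u, v)\<in>P. u \<in> set vs \<and> v \<in> set vs) \<and>
    (\<exists>(u, v)\<in>bdry A - P. u \<in> set vs \<and> v \<in> set vs)"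
proof (rule ccontr)
  assume con: "\<not> ?thesis"
  have mem: "u \<in> set vs \<and> v \<in> set vs" if "(u, v) \<in> set (zip vs (tl vs))" for u v and vs :: "'a list"
    using that by (cases vs) (auto dest: set_zip_leftD set_zip_rightD)
  have PA: "u \<in> A \<and> v \<notin> A" if "(u, v) \<in> P" for u v using that P(1) by (auto simp: bdry_def)
  have "\<not> crossing_parity (P \<union> P\<inverse>) vs" if vs: "short_closed m vs" for vs
  proof (cases "\<exists>(u, v)\<in>P. u \<in> set vs \<and> v \<in> set vs")
    case False
    then show ?thesis using mem by (intro crossing_parity_False) fastforce
  next
    case True
    then have no: "\<not> (u \<in> set vs \<and> v \<in> set vs)" if "(u, v) \<in> bdry A - P" for u v
      using con vs that by blast
    have "(u, v) \<in> P \<union> P\<inverse> \<longleftrightarrow> (u \<in> A) \<noteq> (v \<in> A)" if uv: "(u, v) \<in> set (zip vs (tl vs))" for u v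
    proof -
      have "nb u v" "nb v u" 
        using successively_zip[OF _ uv] vs nb_sym unfolding short_closed_def by blast+
      then show ?thesis using no[of u v] no[of v u] mem[OF uv] PA by (auto simp: bdry_def)
    qed
    then show ?thesis using crossing_parity_coboundary[of vs _ A] vs unfolding short_closed_def by metis
  qed
  then obtain S where S: "\<And>u v. nb u v \<Longrightarrow> (u, v) \<in> P \<union> P\<inverse> \<longleftrightarrow> (u \<in> S) \<noteq> (v \<in> S)"
    using coboundary[of "P \<union> P\<inverse>"] by (auto simp: sym_Un_converse)
  have const: "x \<in> S \<longleftrightarrow> y \<in> S" if "x \<in> B" "y \<in> B" "B = A \<or> B = V - A" for x y B
  proof -
    have "conn B" using A that unfolding tight_def by auto
    have "False" if xy: "x \<in> B" "y \<in> B" "x \<in> S" "y \<notin> S" for x y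
    proof -
      obtain u v where uv: "u \<in> B" "u \<in> S" "v \<in> B" "v \<notin> S" "nb u v"
        using connD[OF \<open>conn B\<close> xy(1,3,2,4)] by blast
      then have "(u, v) \<in> P \<or> (v, u) \<in> P" using S[OF uv(5)] by simp
      then show False using PA[of u v] PA[of v u] uv(1,3) \<open>B = A \<or> B = V - A\<close> by auto
    qed
    then show ?thesis using that by blast
  qed
  obtain a b c d where ab: "(a, b) \<in> P" and cd: "(c, d) \<in> bdry A" "(c, d) \<notin> P" using P by auto
  have ab': "nb a b" "a \<in> A" "b \<in> V - A" using ab P(1) by (auto simp: bdry_def nb_in2)
  have cd': "nb c d" "c \<in> A" "d \<in> V - A" using cd by (auto simp: bdry_def nb_in2)
  have "(c, d) \<notin> P\<inverse>" using cd' PA by auto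
  then show False using const[OF ab'(2) cd'(2)] const[OF ab'(3) cd'(3)] S[OF ab'(1)] S[OF cd'(1)] ab cd(2) by simp
qed

section \<open>Balls, and finiteness of families of tight cuts\<close>

primrec ball :: "nat \<Rightarrow> 'a set \<Rightarrow> 'a set" where
  "ball 0 S = S"
| "ball (Suc n) S = ball n (S \<union> {v. \<exists>u\<in>S. nb u v})"

lemma finite_ball: "finite S \<Longrightarrow> finite (ball n S)"
proof (induction n arbitrary: S)
  case (Suc n)
  have "{v. \<exists>u\<in>S. nb u v} = (\<Union>u\<in>S. {v. nb u v})" by auto
  then have "finite (S \<union> {v. \<exists>u\<in>S. nb u v})" using Suc.prems locally_fin by auto
  then show ?case using Suc.IH by simp
qed auto

lemma ball_incr: "S \<subseteq> ball n S"
proof (induction n arbitrary: S)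
  case (Suc n)
  show ?case using Suc.IH[of "S \<union> {v. \<exists>u\<in>S. nb u v}"] by auto
qed auto

lemma ball_ball: "ball n (ball k S) = ball (k + n) S"
  by (induction k arbitrary: S) auto

lemma ball_mono2: "n \<le> k \<Longrightarrow> ball n S \<subseteq> ball k S"
  using ball_ball[of "k - n" n S] ball_incr[of "ball n S" "k - n"] by simp

lemma walk_subset_ball:
  assumes "successively nb vs" "x \<in> set vs" "x \<in> S"
  shows "set vs \<subseteq> ball (length vs) S"
  using assms
proof (induction vs arbitrary: x S)
  case (Cons v vs)
  show ?case
  proof (cases "vs = []")
    case True then show ?thesis using Cons.prems ball_incr[of S "Suc 0"] by auto
  next
    case False
    then have nb: "nb v (hd vs)" "successively nb vs" using Cons.prems by (auto simp: successively_Cons)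
    let ?S = "S \<union> {v. \<exists>u\<in>S. nb u v}"
    have "\<exists>y\<in>set vs. y \<in> ?S"
    proof (cases "x = v")
      case True then show ?thesis using Cons.prems(3) nb(1) hd_in_set[OF False] by blast
    next
      case False then show ?thesis using Cons.prems(2,3) by auto
    qed
    then obtain y where "y \<in> set vs" "y \<in> ?S" ..
    then have 1: "set vs \<subseteq> ball (length vs) ?S" by (rule Cons.IH[OF nb(2)])
    have "v \<in> ball (Suc (length vs)) S"
    proof (cases "x = v")
      case True then show ?thesis using Cons.prems ball_incr by blast
    next
      case False
      then have "x \<in> set vs" using Cons.prems(2) by simp
      then have "set vs \<subseteq> ball (length vs) S" using Cons.IH[OF nb(2)] Cons.prems(3) by blast
      then have "hd vs \<in> ball (length vs) S" using hd_in_set[OF \<open>vs \<noteq> []\<close>] by blast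
      then have "v \<in> ball 1 (ball (length vs) S)" using nb_sym[OF nb(1)] by auto
      then show ?thesis unfolding ball_ball by simp
    qed
    then show ?thesis using 1 by simp
  qed
qed auto

text \<open>The boundary of a tight cut is connected along short closed walks, and each of these enlarges
  the radius by at most their length.\<close>
lemma tight_bdry_in_ball:
  assumes D: "tight D" and ab: "(a, b) \<in> bdry D"
  shows "bdry D \<subseteq> ball (card (bdry D) * Suc m) {a, b} \<times> ball (card (bdry D) * Suc m) {a, b}"
proof -
  let ?B = "\<lambda>j. ball (j * Suc m) {a, b} \<times> ball (j * Suc m) {a, b}"
  have fin: "finite (bdry D)" using D unfolding tight_def by auto
  \<comment> \<open>Each round reaches a further boundary edge until none is left, so
    \<open>card (bdry D)\<close> rounds suffice. A round costs radius \<open>Suc m\<close>, the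
    largest number of entries of a short closed walk.\<close>
  have "min (Suc j) (card (bdry D)) \<le> card (bdry D \<inter> ?B j)" for j
  proof (induction j)
    case 0
    have "bdry D \<inter> ?B 0 \<noteq> {}" using ab by auto
    then have "card (bdry D \<inter> ?B 0) \<noteq> 0" using fin by (metis card_0_eq finite_Int)
    then show ?case by linarith
  next
    case (Suc j)
    have mono: "bdry D \<inter> ?B j \<subseteq> bdry D \<inter> ?B (Suc j)"
      using ball_mono2[of "j * Suc m" "Suc j * Suc m" "{a, b}"] by auto
    show ?case
    proof (cases "bdry D \<inter> ?B j = bdry D")
      case True
      then have "bdry D \<inter> ?B (Suc j) = bdry D" using mono by blast
      then show ?thesis by simp
    next
      case False
      have "(a, b) \<in> bdry D \<inter> ?B j" using ab ball_incr[of "{a, b}" "j * Suc m"] by blast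
      then have "bdry D \<inter> ?B j \<noteq> {}" by blast
      then obtain vs u v c d where vs: "short_closed m vs" "(u, v) \<in> bdry D \<inter> ?B j" "u \<in> set vs"
        "(c, d) \<in> bdry D - ?B j" "c \<in> set vs" "d \<in> set vs"
        using short_connect[OF D _ _ False] by blast
      have "set vs \<subseteq> ball (length vs) (ball (j * Suc m) {a, b})"
        by (rule walk_subset_ball) (use vs in \<open>auto simp: short_closed_def\<close>)
      also have "\<dots> \<subseteq> ball (Suc j * Suc m) {a, b}"
        unfolding ball_ball using vs(1) by (intro ball_mono2) (auto simp: short_closed_def)
      finally have "(c, d) \<in> bdry D \<inter> ?B (Suc j)" using vs by auto
      then have "bdry D \<inter> ?B j \<subset> bdry D \<inter> ?B (Suc j)" using mono vs(4) by blast
      then have "card (bdry D \<inter> ?B j) < card (bdry D \<inter> ?B (Suc j))"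
        using fin by (intro psubset_card_mono) auto
      then show ?thesis using Suc.IH by linarith
    qed
  qed
  from this[of "card (bdry D)"] have "card (bdry D) \<le> card (bdry D \<inter> ?B (card (bdry D)))" by simp
  then have "bdry D \<inter> ?B (card (bdry D)) = bdry D" using fin by (intro card_seteq) auto
  then show ?thesis by blast
qed

lemma bdry_inj:
  assumes "tight D" "tight D'" "bdry D = bdry D'" shows "D = D'"
proof -
  obtain a b where "(a, b) \<in> bdry D" using tight_bdry_nonempty[OF assms(1)] by auto
  then have "a \<in> D" "a \<in> D'" using assms(3) by (auto simp: bdry_def)
  then show ?thesis using subset_of_bdry_subset[of D a D'] subset_of_bdry_subset[of D' a D] assms
    unfolding tight_def by blast
qed

text \<open>The boundary lies in a finite ball around the edge whose radius depends only on
  \<open>n\<close> and \<open>m\<close>, and by \<open>bdry_inj\<close> it determines the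
  cut.\<close>

lemma finite_tight_at_edge: "finite {D. tight D \<and> card (bdry D) \<le> n \<and> (a, b) \<in> bdry D}"
proof -
  let ?B = "ball (n * Suc m) {a, b}"
  let ?X = "{D. tight D \<and> card (bdry D) \<le> n \<and> (a, b) \<in> bdry D}"
  have "bdry ` ?X \<subseteq> Pow (?B \<times> ?B)"
  proof safe
    fix D u v assume D: "tight D" "card (bdry D) \<le> n" "(a, b) \<in> bdry D" "(u, v) \<in> bdry D"
    have "ball (card (bdry D) * Suc m) {a, b} \<subseteq> ?B" by (rule ball_mono2[OF mult_le_mono1[OF D(2)]])
    then show "u \<in> ?B" "v \<in> ?B" using tight_bdry_in_ball[OF D(1,3)] D(4) by blast+
  qed
  moreover have "finite (Pow (?B \<times> ?B))" using finite_ball by simp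
  ultimately have "finite (bdry ` ?X)" by (rule finite_subset)
  moreover have "inj_on bdry ?X" by (rule inj_onI) (simp add: bdry_inj)
  ultimately show "finite ?X" by (rule finite_imageD)
qed

text \<open>The vertices \<open>y\<close> with a finite family are closed under adjacency: a cut
  separating \<open>x\<close> from \<open>v\<close> but not from its neighbour \<open>u\<close> has
  \<open>(u, v)\<close> in its boundary. The family is empty for \<open>y = x\<close>, and
  connectedness does the rest.\<close>

lemma finite_tight_separating:
  assumes "x \<in> V" "y \<in> V"
  shows "finite {D. tight D \<and> card (bdry D) \<le> n \<and> x \<in> D \<and> y \<notin> D}"
proof (rule ccontr)
  let ?F = "\<lambda>y. {D. tight D \<and> card (bdry D) \<le> n \<and> x \<in> D \<and> y \<notin> D}"
  let ?S = "{y \<in> V. finite (?F y)}"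
  assume "infinite (?F y)"
  then have y: "y \<notin> ?S" by simp
  have x: "x \<in> ?S" using assms by simp
  obtain u v where uv: "u \<in> V \<inter> ?S" "v \<in> V - ?S" "nb u v"
    using connD[OF connected assms(1) x assms(2) y] by (elim bexE)
  have "?F v \<subseteq> ?F u \<union> {D. tight D \<and> card (bdry D) \<le> n \<and> (u, v) \<in> bdry D}"
    using uv(3) by (auto simp: bdry_def)
  moreover have "finite (?F u)" using uv(1) by blast
  ultimately have "finite (?F v)" using finite_tight_at_edge finite_subset by (meson finite_UnI)
  then show False using uv(2) by blast
qed

text \<open>Both sides of a crossing \<open>D\<close> are connected and meet \<open>A\<close> and
  its complement, so each contains an edge of \<open>bdry A\<close>. Thus \<open>D\<close> separates
  two vertices of the finite set \<open>?Z\<close>.\<close>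

lemma finite_crossing:
  assumes A: "A \<subseteq> V" "finite (bdry A)"
  shows "finite {D. tight D \<and> card (bdry D) \<le> n \<and> \<not> nested_in V D A}"
proof -
  let ?Z = "fst ` bdry A"
  have "{D. tight D \<and> card (bdry D) \<le> n \<and> \<not> nested_in V D A} \<subseteq>
    (\<Union>x\<in>?Z. \<Union>y\<in>?Z. {D. tight D \<and> card (bdry D) \<le> n \<and> x \<in> D \<and> y \<notin> D})"
  proof (rule subsetI, elim CollectE conjE)
    fix D assume D: "tight D" "card (bdry D) \<le> n" "\<not> nested_in V D A"
    have DV: "D \<subseteq> V" "conn D" "conn (V - D)" using D(1) unfolding tight_def by auto
    obtain p q where "p \<in> D" "p \<in> A" "q \<in> D" "q \<notin> A" using D(3) unfolding nested_in_def by blast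
    from connD[OF DV(2) this] obtain x where x: "x \<in> D" "x \<in> ?Z" 
      by (force simp: bdry_def)
    obtain p q where "p \<in> V - D" "p \<in> A" "q \<in> V - D" "q \<notin> A" 
      using D(3) A(1) DV(1) unfolding nested_in_def by blast
    from connD[OF DV(3) this] obtain y where y: "y \<notin> D" "y \<in> ?Z" 
      by (force simp: bdry_def)
    show "D \<in> (\<Union>x\<in>?Z. \<Union>y\<in>?Z. {D. tight D \<and> card (bdry D) \<le> n \<and> x \<in> D \<and> y \<notin> D})"
      using x y D by blast
  qed
  moreover have "finite (\<Union>x\<in>?Z. \<Union>y\<in>?Z. {D. tight D \<and> card (bdry D) \<le> n \<and> x \<in> D \<and> y \<notin> D})"
    using A(2) by (intro finite_UN_I finite_imageI finite_tight_separating) (auto simp: bdry_def nb_in)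
  ultimately show ?thesis using finite_subset by blast
qed

end

section \<open>Nested families of optimal cuts\<close>

context simple_graph begin

lemma aut_image_subset: "aut g \<Longrightarrow> A \<subseteq> V \<Longrightarrow> g ` A \<subseteq> V"
  unfolding aut_def bij_betw_def by blast

lemma bdry_image:
  assumes g: "aut g" and A: "A \<subseteq> V"
  shows "bdry (g ` A) = map_prod g g ` bdry A"
proof -
  have inj: "inj_on g V" and V: "g ` V = V" and nb: "\<And>u v. u \<in> V \<Longrightarrow> v \<in> V \<Longrightarrow> nb (g u) (g v) \<longleftrightarrow> nb u v"
    using g unfolding aut_def bij_betw_def by auto
  have mem: "g v \<in> g ` A \<longleftrightarrow> v \<in> A" if "v \<in> V" for v
    using inj_on_image_mem_iff[OF inj that A] .
  show ?thesis
  proof (intro subset_antisym subsetI)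
    fix e assume "e \<in> bdry (g ` A)"
    then obtain u q where e: "e = (g u, q)" "u \<in> A" "nb (g u) q" "q \<notin> g ` A"
      unfolding bdry_def by blast
    then obtain v where v: "q = g v" "v \<in> V" using nb_in2[OF e(3)] V by blast
    have "(u, v) \<in> bdry A" using e v A mem nb by (auto simp: bdry_def)
    then show "e \<in> map_prod g g ` bdry A" using e(1) v(1) by force
  next
    fix e assume "e \<in> map_prod g g ` bdry A"
    then obtain u v where "e = (g u, g v)" "nb u v" "u \<in> A" "v \<notin> A" by (auto simp: bdry_def)
    then show "e \<in> bdry (g ` A)" using mem[of v] nb[of u v] nb_in nb_in2 by (auto simp: bdry_def)
  qed
qed

lemma card_bdry_image:
  assumes g: "aut g" and A: "A \<subseteq> V"
  shows "card (bdry (g ` A)) = card (bdry A)"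
proof -
  have "inj_on g V" using g unfolding aut_def bij_betw_def by auto
  then have "inj_on (map_prod g g) (bdry A)"
    by (auto simp: inj_on_def bdry_def nb_in nb_in2)
  then show ?thesis unfolding bdry_image[OF assms] by (rule card_image)
qed

lemma finite_bdry_image: "aut g \<Longrightarrow> A \<subseteq> V \<Longrightarrow> finite (bdry A) \<Longrightarrow> finite (bdry (g ` A))"
  by (simp add: bdry_image)

lemma aut_compl: "aut g \<Longrightarrow> A \<subseteq> V \<Longrightarrow> g ` (V - A) = V - g ` A"
  unfolding aut_def bij_betw_def using inj_on_image_set_diff[of g V V A] by auto

lemma aut_inv:
  assumes "aut g" shows "aut (inv_into V g)"
proof -
  have bij: "bij_betw g V V" using assms unfolding aut_def by auto
  then have "inv_into V g v \<in> V" "g (inv_into V g v) = v" if "v \<in> V" for v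
    using that by (auto simp: bij_betw_def f_inv_into_f inv_into_into)
  then show ?thesis using bij_betw_inv_into[OF bij] assms unfolding aut_def by metis
qed

lemma aut_inv_image:
  assumes "aut g" "B \<subseteq> V"
  shows "g ` inv_into V g ` B = B" "inv_into V g ` g ` B = B"
proof -
  have "inj_on g V" "g ` V = V" using assms unfolding aut_def bij_betw_def by auto
  then show "g ` inv_into V g ` B = B" "inv_into V g ` g ` B = B"
    using assms(2) by (auto simp: image_inv_into_cancel inv_into_image_cancel)
qed

lemma endlike_image:
  assumes g: "aut g" and \<rho>: "endlike \<rho>"
  shows "endlike (g \<circ> \<rho>)"
  unfolding endlike_def
proof (intro conjI allI impI)
  have "range \<rho> \<subseteq> V" using \<rho> unfolding endlike_def by auto
  then show "range (g \<circ> \<rho>) \<subseteq> V" using aut_image_subset[OF g, of "range \<rho>"] by auto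
  fix A assume A: "A \<subseteq> V" "finite (bdry A)"
  define B where "B = inv_into V g ` A"
  have B: "B \<subseteq> V" "finite (bdry B)" "g ` B = A"
    using A aut_inv[OF g] aut_image_subset finite_bdry_image aut_inv_image[OF g] unfolding B_def by auto
  then have B': "g ` (V - B) = V - A" using aut_compl[OF g] by auto
  have "(\<forall>\<^sub>F k in sequentially. \<rho> k \<in> B) \<or> (\<forall>\<^sub>F k in sequentially. \<rho> k \<in> V - B)"
    using \<rho> B unfolding endlike_def by auto
  then show "(\<forall>\<^sub>F k in sequentially. (g \<circ> \<rho>) k \<in> A) \<or> (\<forall>\<^sub>F k in sequentially. (g \<circ> \<rho>) k \<in> V - A)"
  proof
    assume "\<forall>\<^sub>F k in sequentially. \<rho> k \<in> B"
    then show ?thesis using B(3) by (intro disjI1) (auto elim!: eventually_mono)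
  next
    assume "\<forall>\<^sub>F k in sequentially. \<rho> k \<in> V - B"
    then have "\<forall>\<^sub>F k in sequentially. g (\<rho> k) \<in> V - A"
      by (rule eventually_mono) (use B' in blast)
    then show ?thesis by simp
  qed
qed

lemma separates_image:
  assumes g: "aut g" and s: "separates A \<rho> \<sigma>"
  shows "separates (g ` A) (g \<circ> \<rho>) (g \<circ> \<sigma>)"
proof -
  have A: "A \<subseteq> V" "finite (bdry A)" and ev: "\<forall>\<^sub>F k in sequentially. \<rho> k \<in> A" "\<forall>\<^sub>F k in sequentially. \<sigma> k \<in> V - A"
    using s unfolding separates_def by auto
  have "\<forall>\<^sub>F k in sequentially. g (\<rho> k) \<in> g ` A" using ev(1) by (rule eventually_mono) blast
  moreover have "\<forall>\<^sub>F k in sequentially. g (\<sigma> k) \<in> V - g ` A"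
    using ev(2) by (rule eventually_mono) (use aut_compl[OF g A(1)] in blast)
  ultimately show ?thesis
    unfolding separates_def using aut_image_subset[OF g A(1)] finite_bdry_image[OF g A] by simp
qed

lemma edge_conn_ge_image:
  assumes g: "aut g" and e: "edge_conn_ge k \<rho> \<sigma>"
  shows "edge_conn_ge k (g \<circ> \<rho>) (g \<circ> \<sigma>)"
  unfolding edge_conn_ge_def
proof (intro conjI allI impI)
  have "endlike \<rho>" "endlike \<sigma>" using e unfolding edge_conn_ge_def by auto
  then show "endlike (g \<circ> \<rho>)" "endlike (g \<circ> \<sigma>)" using endlike_image[OF g] by auto
  have inj: "inj_on g V" using g unfolding aut_def bij_betw_def by auto
  have "\<rho> n \<in> V" "\<sigma> n \<in> V" for n using \<open>endlike \<rho>\<close> \<open>endlike \<sigma>\<close> unfolding endlike_def by auto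
  then have *: "inv_into V g \<circ> (g \<circ> \<rho>) = \<rho>" "inv_into V g \<circ> (g \<circ> \<sigma>) = \<sigma>"
    using inv_into_f_f[OF inj] by (auto simp: fun_eq_iff)
  fix B assume B: "separates B (g \<circ> \<rho>) (g \<circ> \<sigma>)"
  then have "separates (inv_into V g ` B) \<rho> \<sigma>"
    using separates_image[OF aut_inv[OF g] B] * by simp
  then have "k \<le> card (bdry (inv_into V g ` B))" using e unfolding edge_conn_ge_def by auto
  then show "k \<le> card (bdry B)"
    using card_bdry_image[OF aut_inv[OF g]] B unfolding separates_def by simp
qed

lemma optimal_image: "aut g \<Longrightarrow> optimal k A \<Longrightarrow> optimal k (g ` A)"
  using optimal_subset[of k A] card_bdry_image[of g A] separates_image edge_conn_ge_image
  unfolding optimal_def by metis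

end

section \<open>Uncrossing into invariant nested families\<close>

context short_cycle_graph begin

definition invariant :: "'a set set \<Rightarrow> bool" where
  "invariant F \<longleftrightarrow> (\<forall>g A. aut g \<longrightarrow> A \<in> F \<longrightarrow> g ` A \<in> F)"

lemma finite_crossing_optimal:
  assumes "optimal k A" "F \<subseteq> (\<Union>l\<le>n. Collect (optimal l))"
  shows "finite {D \<in> F. \<not> nested_in V D A}"
proof (rule finite_subset)
  show "{D \<in> F. \<not> nested_in V D A} \<subseteq> {D. tight D \<and> card (bdry D) \<le> n \<and> \<not> nested_in V D A}"
    using assms(2) optimal_tight optimal_card by blast
  show "finite {D. tight D \<and> card (bdry D) \<le> n \<and> \<not> nested_in V D A}"
    by (rule finite_crossing[OF optimal_subset[OF assms(1)] optimal_finite[OF assms(1)]])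
qed

lemma nested_corner_compl:
  assumes "A \<subseteq> V" "B \<subseteq> V" "D \<subseteq> V" "A' \<in> {A, V - A}" "B' \<in> {B, V - B}"
  shows "nested_in V D A' \<longleftrightarrow> nested_in V D A" "nested_in V A' B' \<longleftrightarrow> nested_in V A B"
proof -
  show "nested_in V D A' \<longleftrightarrow> nested_in V D A" using assms nested_in_compl by blast
  have "nested_in V A' B' \<longleftrightarrow> nested_in V A' B" using assms nested_in_compl[of A' V B] by blast
  also have "\<dots> \<longleftrightarrow> nested_in V B A'" using nested_in_sym by blast
  also have "\<dots> \<longleftrightarrow> nested_in V B A" using assms nested_in_compl[of B V A] by blast
  also have "\<dots> \<longleftrightarrow> nested_in V A B" using nested_in_sym by blast
  finally show "nested_in V A' B' \<longleftrightarrow> nested_in V A B" .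
qed

lemma exists_min:
  fixes f :: "'b \<Rightarrow> nat"
  assumes "x \<in> X" shows "\<exists>y\<in>X. \<forall>z\<in>X. f y \<le> f z"
  using ex_has_least_nat[of "\<lambda>x. x \<in> X" x f] assms by blast

text \<open>An optimal cut crossing as few members of the family as possible crosses none: otherwise one of
  its corners is optimal as well and crosses fewer.\<close>
lemma optimal_nested_with:
  assumes F: "F \<subseteq> (\<Union>l\<le>n. Collect (optimal l))" "\<And>A B. A \<in> F \<Longrightarrow> B \<in> F \<Longrightarrow> nested_in V A B"
    and ex: "optimal n A0"
  shows "\<exists>A. optimal n A \<and> (\<forall>D\<in>F. nested_in V D A)"
proof -
  let ?c = "\<lambda>A. {D \<in> F. \<not> nested_in V D A}"
  obtain A where A: "optimal n A" and min: "\<And>B. optimal n B \<Longrightarrow> card (?c A) \<le> card (?c B)"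
    using exists_min[of A0 "Collect (optimal n)" "\<lambda>A. card (?c A)"] ex by auto
  have "nested_in V B A" if B: "B \<in> F" for B
  proof (rule ccontr)
    assume cross: "\<not> nested_in V B A"
    obtain l where l: "l \<le> n" "optimal l B" using F(1) B by auto
    obtain A' B' where A': "A' \<in> {A, V - A}" and B': "B' \<in> {B, V - B}" and opt: "optimal n (A' \<inter> B')"
      using uncross[OF A l(2,1)] by blast
    have AV: "A \<subseteq> V" and BV: "B \<subseteq> V" using A l optimal_subset by auto
    have cr': "\<not> nested_in V A' B'"
      using nested_corner_compl(2)[OF AV BV BV A' B'] cross nested_in_sym by blast
    have "?c (A' \<inter> B') \<subset> ?c A"
    proof (rule psubsetI)
      show "?c (A' \<inter> B') \<subseteq> ?c A"
      proof safe
        fix D assume D: "D \<in> F" "\<not> nested_in V D (A' \<inter> B')" "nested_in V D A"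
        have DV: "D \<subseteq> V" using D(1) F(1) optimal_subset by blast
        have "nested_in V D A'" "nested_in V D B'"
          using nested_corner_compl(1)[OF AV BV DV A' B'] nested_corner_compl(1)[OF BV AV DV B' A'] D F(2) B by auto
        moreover have "A' \<subseteq> V" "B' \<subseteq> V" using A' B' AV BV by auto
        ultimately show False using nested_in_corners(1)[of A' V B' D] cr' D(2) DV by blast
      qed
      \<comment> \<open>The corner lies within one side of \<open>B\<close>, so \<open>B\<close> no
        longer crosses; this makes the inclusion proper.\<close>
      have "nested_in V B (A' \<inter> B')" using B' BV unfolding nested_in_def by auto
      then show "?c (A' \<inter> B') \<noteq> ?c A" using B cross by blast
    qed
    then have "card (?c (A' \<inter> B')) < card (?c A)"
      using finite_crossing_optimal[OF A F(1)] by (rule psubset_card_mono[rotated])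
    then show False using min[OF opt] by simp
  qed
  then show ?thesis using A by blast
qed

text \<open>\<open>G\<close> collects all cuts of \<open>Q\<close> that cross as few members of
  \<open>Q\<close> as possible; no choice is involved, hence invariance. If two members crossed, the
  corners \<open>A' \<inter> B'\<close> and \<open>A' \<union> B'\<close> would also lie in
  \<open>Q\<close>, with a total number of crossings below twice the minimum.\<close>

lemma nested_family_step:
  assumes F: "F \<subseteq> (\<Union>l\<le>n. Collect (optimal l))" "\<And>A B. A \<in> F \<Longrightarrow> B \<in> F \<Longrightarrow> nested_in V A B"
      "invariant F"
    and ex: "optimal n A0"
  shows "\<exists>G\<subseteq>Collect (optimal n). G \<noteq> {} \<and> invariant G \<and> (\<forall>A\<in>G. \<forall>B\<in>F \<union> G. nested_in V B A)"
proof -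
  define Q where "Q = {A. optimal n A \<and> (\<forall>D\<in>F. nested_in V D A)}"
  let ?c = "\<lambda>A. {D \<in> Q. \<not> nested_in V D A}"
  define G where "G = {A \<in> Q. \<forall>B\<in>Q. card (?c A) \<le> card (?c B)}"
  have QV: "A \<subseteq> V" "optimal n A" if "A \<in> Q" for A using that optimal_subset unfolding Q_def by auto
  have FV: "A \<subseteq> V" if "A \<in> F" for A using that F(1) optimal_subset by blast
  have fin: "finite (?c A)" if "A \<in> Q" for A
    by (rule finite_crossing_optimal[OF QV(2)[OF that], where n=n]) (use QV in blast)
  have "Q \<noteq> {}" using optimal_nested_with[OF F(1,2) ex] unfolding Q_def by blast
  then have "G \<noteq> {}" using exists_min[of _ Q "\<lambda>A. card (?c A)"] unfolding G_def by blast
  have invQ: "g ` A \<in> Q" if g: "aut g" and A: "A \<in> Q" for g A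
  proof -
    have "nested_in V D (g ` A)" if D: "D \<in> F" for D
    proof -
      have "inv_into V g ` D \<in> F" using F(3) D aut_inv[OF g] unfolding invariant_def by blast
      then have "nested_in V (inv_into V g ` D) A" "inv_into V g ` D \<subseteq> V" using A FV unfolding Q_def by auto
      then have "nested_in V (g ` inv_into V g ` D) (g ` A)"
        using nested_in_image[of g V] g QV(1)[OF A] unfolding aut_def by blast
      then show ?thesis using aut_inv_image(1)[OF g FV[OF D]] by simp
    qed
    then show ?thesis using optimal_image[OF g QV(2)[OF A]] unfolding Q_def by blast
  qed
  have le: "card (?c (g ` A)) \<le> card (?c A)" if g: "aut g" and A: "A \<in> Q" for g A
  proof -
    have "?c (g ` A) \<subseteq> (`) g ` ?c A"
    proof safe
      fix D assume D: "D \<in> Q" "\<not> nested_in V D (g ` A)"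
      have D': "inv_into V g ` D \<in> Q" using invQ aut_inv[OF g] D(1) by blast
      have eq: "g ` inv_into V g ` D = D" using aut_inv_image(1)[OF g] QV(1) D(1) by blast
      have "\<not> nested_in V (inv_into V g ` D) A"
        using nested_in_image[of g V "inv_into V g ` D" A] D(2) eq g QV(1)[OF D'] QV(1)[OF A] 
        unfolding aut_def by simp
      then have "inv_into V g ` D \<in> ?c A" using D' by blast
      then show "D \<in> (`) g ` ?c A" using eq by (metis (no_types, lifting) image_eqI)
    qed
    then show ?thesis using fin[OF A] by (meson card_image_le card_mono finite_imageI le_trans)
  qed
  have invG: "invariant G"
    unfolding invariant_def
  proof (intro allI impI)
    fix g A assume g: "aut g" and "A \<in> G"
    then have A: "A \<in> Q" and min: "\<And>B. B \<in> Q \<Longrightarrow> card (?c A) \<le> card (?c B)" unfolding G_def by auto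
    have "card (?c (g ` A)) \<le> card (?c B)" if "B \<in> Q" for B
      using le[OF g A] min[OF that] by (rule le_trans)
    then show "g ` A \<in> G" using invQ[OF g A] unfolding G_def by blast
  qed
  have GG: "nested_in V A B" if "A \<in> G" "B \<in> G" for A B
  proof (rule ccontr)
    assume cross: "\<not> nested_in V A B"
    have AB: "A \<in> Q" "B \<in> Q" and min: "\<And>C. C \<in> Q \<Longrightarrow> card (?c A) \<le> card (?c C)" 
      "card (?c A) = card (?c B)"
      using that unfolding G_def by (auto intro: antisym)
    have AV: "A \<subseteq> V" and BV: "B \<subseteq> V" using AB QV by auto
    obtain A' B' where A': "A' \<in> {A, V - A}" and B': "B' \<in> {B, V - B}" 
      and opt: "optimal n (A' \<inter> B')" "optimal n (A' \<union> B')"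
      using uncross[OF QV(2)[OF AB(1)] QV(2)[OF AB(2)] order_refl] by blast
    have cr': "\<not> nested_in V A' B'"
      using nested_corner_compl(2)[OF AV BV BV A' B'] cross by blast
    have V': "A' \<subseteq> V" "B' \<subseteq> V" using A' B' AV BV by auto
    have nA: "nested_in V D A' \<longleftrightarrow> nested_in V D A" if "D \<subseteq> V" for D
      using nested_corner_compl(1)[OF AV BV that A' B'] .
    have nB: "nested_in V D B' \<longleftrightarrow> nested_in V D B" if "D \<subseteq> V" for D
      using nested_corner_compl(1)[OF BV AV that B' A'] .
    have "nested_in V D (A' \<inter> B')" "nested_in V D (A' \<union> B')" if "D \<in> F" for D
      using nested_in_corners[OF V' FV[OF that] cr'] nA[OF FV[OF that]] nB[OF FV[OF that]] AB that
      unfolding Q_def by blast+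
    then have C: "A' \<inter> B' \<in> Q" "A' \<union> B' \<in> Q" using opt unfolding Q_def by auto
    have sub: "?c (A' \<inter> B') \<union> ?c (A' \<union> B') \<subseteq> ?c A \<union> ?c B"
    proof (rule subsetI)
      fix D assume D: "D \<in> ?c (A' \<inter> B') \<union> ?c (A' \<union> B')"
      then have "D \<in> Q" "D \<subseteq> V" using QV by auto
      then show "D \<in> ?c A \<union> ?c B"
        using D nested_in_corners[OF V' \<open>D \<subseteq> V\<close> cr'] nA[OF \<open>D \<subseteq> V\<close>] nB[OF \<open>D \<subseteq> V\<close>] by blast
    qed
    have int: "?c (A' \<inter> B') \<inter> ?c (A' \<union> B') \<subseteq> ?c A \<inter> ?c B"
    proof (rule subsetI)
      fix D assume D: "D \<in> ?c (A' \<inter> B') \<inter> ?c (A' \<union> B')"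
      then have "D \<in> Q" "D \<subseteq> V" using QV by auto
      then show "D \<in> ?c A \<inter> ?c B"
        using D nested_in_some_corner[OF _ V' \<open>D \<subseteq> V\<close>] nested_in_some_corner[OF _ V'(2,1) \<open>D \<subseteq> V\<close>]
          nA[OF \<open>D \<subseteq> V\<close>] nB[OF \<open>D \<subseteq> V\<close>] by (simp add: Int_commute Un_commute) blast
    qed
    \<comment> \<open>\<open>A\<close> is counted among the cuts crossing \<open>B\<close> but
      crosses neither corner: the source of the strict inequality.\<close>
    have "nested_in V A (A' \<inter> B')" "nested_in V A (A' \<union> B')"
      using A' AV V'(2) unfolding nested_in_def by auto
    then have "A \<in> ?c A \<union> ?c B" "A \<notin> ?c (A' \<inter> B') \<union> ?c (A' \<union> B')" using cross AB by auto
    then have "?c (A' \<inter> B') \<union> ?c (A' \<union> B') \<subset> ?c A \<union> ?c B" using sub by blast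
    then have "card (?c (A' \<inter> B') \<union> ?c (A' \<union> B')) < card (?c A \<union> ?c B)"
      using fin AB by (intro psubset_card_mono) auto
    moreover have "card (?c (A' \<inter> B') \<inter> ?c (A' \<union> B')) \<le> card (?c A \<inter> ?c B)"
      using int fin AB by (intro card_mono) auto
    ultimately have "card (?c (A' \<inter> B')) + card (?c (A' \<union> B')) < card (?c A) + card (?c B)"
      using card_Un_Int[OF fin[OF C(1)] fin[OF C(2)]] card_Un_Int[OF fin[OF AB(1)] fin[OF AB(2)]] by linarith
    then show False using min(1)[OF C(1)] min(1)[OF C(2)] min(2) by linarith
  qed
  have "nested_in V B A" if "A \<in> G" "B \<in> F \<union> G" for A B
    using that GG unfolding G_def Q_def by blast
  moreover have "G \<subseteq> Collect (optimal n)" unfolding G_def Q_def by auto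
  ultimately show ?thesis using \<open>G \<noteq> {}\<close> invG by blast
qed

text \<open>Increasing orders match the hypothesis \<open>l \<le> k\<close> of
  \<open>uncross\<close>: the new cuts are uncrossed from the older ones, which stay
  untouched.\<close>

lemma nested_family:
  "\<exists>F\<subseteq>(\<Union>l<n. Collect (optimal l)). (\<forall>A\<in>F. \<forall>B\<in>F. nested_in V A B) \<and> invariant F \<and>
     (\<forall>l<n. (\<exists>A. optimal l A) \<longrightarrow> (\<exists>A\<in>F. optimal l A))"
proof (induction n)
  case 0
  show ?case by (rule exI[of _ "{}"]) (auto simp: invariant_def)
next
  case (Suc n)
  then obtain F where F': "F \<subseteq> (\<Union>l<n. Collect (optimal l)) \<and> (\<forall>A\<in>F. \<forall>B\<in>F. nested_in V A B) \<and>
    invariant F \<and> (\<forall>l<n. (\<exists>A. optimal l A) \<longrightarrow> (\<exists>A\<in>F. optimal l A))" by (elim exE)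
  have F: "F \<subseteq> (\<Union>l<n. Collect (optimal l))" "\<And>A B. A \<in> F \<Longrightarrow> B \<in> F \<Longrightarrow> nested_in V A B"
    "invariant F" "\<And>l. l < n \<Longrightarrow> \<exists>A. optimal l A \<Longrightarrow> \<exists>A\<in>F. optimal l A"
    using F' by simp_all
  have "(\<Union>l<n. Collect (optimal l)) \<subseteq> (\<Union>l<Suc n. Collect (optimal l))" by (rule UN_mono) auto
  then have FS: "F \<subseteq> (\<Union>l<Suc n. Collect (optimal l))" using F(1) by (rule order_trans[rotated])
  show ?case
  proof (cases "\<exists>A. optimal n A")
    case False
    have "\<exists>A\<in>F. optimal l A" if "l < Suc n" "\<exists>A. optimal l A" for l
      using F(4)[of l] that False less_Suc_eq by blast
    then show ?thesis using F(2,3) FS by (intro exI[of _ F]) simp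
  next
    case True
    then obtain A0 where A0: "optimal n A0" by (elim exE)
    have "F \<subseteq> (\<Union>l\<le>n. Collect (optimal l))" using FS by (simp only: lessThan_Suc_atMost)
    then have "\<exists>G\<subseteq>Collect (optimal n). G \<noteq> {} \<and> invariant G \<and> (\<forall>A\<in>G. \<forall>B\<in>F \<union> G. nested_in V B A)"
      by (rule nested_family_step[OF _ _ F(3) A0]) (rule F(2))
    then obtain G where G': "G \<subseteq> Collect (optimal n) \<and> G \<noteq> {} \<and> invariant G \<and>
      (\<forall>A\<in>G. \<forall>B\<in>F \<union> G. nested_in V B A)" by (elim exE)
    have G: "G \<subseteq> Collect (optimal n)" "G \<noteq> {}" "invariant G"
      "\<And>A B. A \<in> G \<Longrightarrow> B \<in> F \<union> G \<Longrightarrow> nested_in V B A"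
      using G' by simp_all
    have "nested_in V A B" if "A \<in> F \<union> G" "B \<in> F \<union> G" for A B
      using that F(2) G(4) nested_in_sym by (metis Un_iff)
    moreover have "invariant (F \<union> G)" using F(3) G(3) unfolding invariant_def by blast
    moreover have "F \<union> G \<subseteq> (\<Union>l<Suc n. Collect (optimal l))"
      using FS G(1) by blast
    moreover have "\<exists>A\<in>F \<union> G. optimal l A" if "l < Suc n" "\<exists>A. optimal l A" for l
      using that F(4)[of l] G(1,2) by (cases "l = n") auto
    ultimately show ?thesis by (intro exI[of _ "F \<union> G"]) blast
  qed
qed

section \<open>Traces on short closed walks and the count of orders\<close>

lemma ball_V: "ball n V = V"
proof (induction n)
  case (Suc n)
  have "V \<union> {v. \<exists>u\<in>V. nb u v} = V" using nb_in2 by blast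
  then show ?case using Suc by simp
qed simp

definition trace_maximal :: "'a set set \<Rightarrow> 'a set \<Rightarrow> 'a set \<Rightarrow> bool" where
  "trace_maximal F U A \<longleftrightarrow> bdry A \<inter> U \<times> U \<noteq> {} \<and> (\<forall>D\<in>F. A \<subset> D \<longrightarrow> D \<inter> U \<noteq> A \<inter> U)"

text \<open>A boundary edge inside \<open>U\<close> starts in both cuts and ends in neither, which
  rules out disjointness and covering. So the cuts are comparable, and maximality of the smaller one
  forces equality.\<close>

lemma trace_maximal_unique:
  assumes "A \<in> F" "B \<in> F" "trace_maximal F U A" "trace_maximal F U B" "A \<inter> U = B \<inter> U" 
    and "nested_in V A B"
  shows "A = B"
proof -
  obtain a b where "(a, b) \<in> bdry A" "a \<in> U" "b \<in> U" using assms(3) unfolding trace_maximal_def by blast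
  then have "a \<in> A" "b \<notin> A" "a \<in> B" "b \<notin> B" "b \<in> V" using assms(5) nb_in2 unfolding bdry_def by blast+
  then have "A \<subseteq> B \<or> B \<subseteq> A" using assms(6) unfolding nested_in_def by blast
  then show ?thesis using assms(1-5) unfolding trace_maximal_def by (metis psubsetI)
qed

text \<open>Suppose there is none, and let \<open>D\<close> be minimal among the larger members
  sharing a boundary edge with \<open>A\<close>. On a short walk through a common boundary edge,
  \<open>A\<close> has the trace of some larger member; that member contains \<open>D\<close>, so
  \<open>D\<close> has this trace as well. By \<open>short_connect\<close> common edges then spread
  over both boundaries.\<close>

lemma exists_trace_maximal:
  assumes F: "\<And>A. A \<in> F \<Longrightarrow> tight A \<and> card (bdry A) \<le> n" "\<And>A B. A \<in> F \<Longrightarrow> B \<in> F \<Longrightarrow> nested_in V A B"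
    and A: "A \<in> F"
  shows "\<exists>vs. short_closed m vs \<and> trace_maximal F (set vs) A"
proof (rule ccontr)
  assume "\<not> ?thesis"
  then have con: "\<exists>D\<in>F. A \<subset> D \<and> D \<inter> set vs = A \<inter> set vs" 
    if "short_closed m vs" "(a, b) \<in> bdry A" "a \<in> set vs" "b \<in> set vs" for vs a b
    using that unfolding trace_maximal_def by blast
  have tA: "tight A" "finite (bdry A)" "A \<noteq> {}" "A \<subseteq> V" using F(1)[OF A] unfolding tight_def by auto
  let ?X = "{D \<in> F. A \<subset> D \<and> bdry D \<inter> bdry A \<noteq> {}}"
  have "?X \<subseteq> (\<Union>(a, b)\<in>bdry A. {D. tight D \<and> card (bdry D) \<le> n \<and> (a, b) \<in> bdry D})"
    using F(1) by fastforce
  moreover have "finite (\<Union>(a, b)\<in>bdry A. {D. tight D \<and> card (bdry D) \<le> n \<and> (a, b) \<in> bdry D})"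
    using tA(2) finite_tight_at_edge by auto
  ultimately have "finite ?X" using finite_subset by blast
  moreover have "?X \<noteq> {}"
  proof -
    obtain a b where ab: "(a, b) \<in> bdry A" using tight_bdry_nonempty[OF tA(1)] by auto
    then have "nb a b" "nb b a" using nb_sym unfolding bdry_def by auto
    \<comment> \<open>The edge and back: two steps, whence the requirement
      \<open>2 \<le> m\<close>.\<close>
    then have "short_closed m [a, b, a]" using m_ge by (simp add: short_closed_def)
    then obtain D where "D \<in> F" "A \<subset> D" "D \<inter> {a, b} = A \<inter> {a, b}" using con[of "[a, b, a]" a b] ab by auto
    moreover from this have "(a, b) \<in> bdry D" using ab unfolding bdry_def by blast
    ultimately show ?thesis using ab by blast
  qed
  ultimately have "\<exists>D\<in>?X. \<forall>D'\<in>?X. D' \<subseteq> D \<longrightarrow> D = D'" by (rule finite_has_minimal)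
  then obtain D where D: "D \<in> ?X" and min': "\<forall>D'\<in>?X. D' \<subseteq> D \<longrightarrow> D = D'" by (elim bexE)
  have min: "D' = D" if "D' \<in> ?X" "D' \<subseteq> D" for D'
    using min'[rule_format, OF that] by (rule sym)
  have DF: "D \<in> F" "A \<subset> D" "bdry D \<inter> bdry A \<noteq> {}" using D by simp_all
  have tD: "tight D" using F(1)[OF DF(1)] by (rule conjunct1)
  have key: "D \<inter> set vs = A \<inter> set vs" 
    if vs: "short_closed m vs" and ab: "(a, b) \<in> bdry A" "(a, b) \<in> bdry D" "a \<in> set vs" "b \<in> set vs" for vs a b
  proof -
    obtain D' where D': "D' \<in> F" "A \<subset> D'" "D' \<inter> set vs = A \<inter> set vs" using con[OF vs ab(1,3,4)] by blast
    then have ab': "(a, b) \<in> bdry D'" using ab unfolding bdry_def by blast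
    then have "D' \<in> ?X" using D' ab(1) by blast
    \<comment> \<open>Both contain \<open>a\<close> and omit \<open>b\<close>, so being nested means
      being comparable.\<close>
    moreover have "D \<subseteq> D' \<or> D' \<subseteq> D"
      using F(2)[OF DF(1) D'(1)] ab(2) ab' nb_in2 unfolding nested_in_def bdry_def by blast
    ultimately have "D \<subseteq> D'" using min[of D'] by auto
    then show ?thesis using D' DF(2) by blast
  qed
  \<comment> \<open>A short walk from a common edge to an edge of \<open>bdry A\<close> outside
    \<open>bdry D\<close> would exhibit different traces. The same argument inside the boundary of
    \<open>D\<close> gives \<open>eq2\<close>.\<close>
  have eq1: "bdry A \<inter> bdry D = bdry A"
  proof (rule ccontr)
    assume ne: "bdry A \<inter> bdry D \<noteq> bdry A"
    obtain vs u v c d where vs: "short_closed m vs" "(u, v) \<in> bdry A \<inter> bdry D" "u \<in> set vs" "v \<in> set vs"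
      "(c, d) \<in> bdry A - bdry A \<inter> bdry D" "c \<in> set vs" "d \<in> set vs"
      using short_connect[OF tA(1) _ _ ne] DF(3) by blast
    have "D \<inter> set vs = A \<inter> set vs" using key[OF vs(1)] vs(2-4) by blast
    then show False using vs(5-7) unfolding bdry_def by blast
  qed
  have eq2: "bdry A = bdry D"
  proof (rule ccontr)
    assume ne: "bdry A \<noteq> bdry D"
    have sub: "bdry A \<subseteq> bdry D" using eq1 by blast
    obtain vs u v c d where vs: "short_closed m vs" "(u, v) \<in> bdry A" "u \<in> set vs" "v \<in> set vs"
      "(c, d) \<in> bdry D - bdry A" "c \<in> set vs" "d \<in> set vs"
      using short_connect[OF tD sub tight_bdry_nonempty[OF tA(1)] ne] by blast
    have "D \<inter> set vs = A \<inter> set vs" using key[OF vs(1)] vs(2-4) sub by blast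
    then show False using vs(5-7) unfolding bdry_def by blast
  qed
  show False using bdry_inj[OF tA(1) tD eq2] DF(2) by blast
qed

text \<open>An automorphism moves a vertex of the short walk into \<open>R\<close> and thus the
  whole walk into \<open>BB\<close>; the moved cut stays in the invariant family and stays
  trace-maximal. \<open>BB\<close> does not depend on \<open>n\<close>, although the family
  does.\<close>

lemma finite_orders: "finite {k. \<exists>A. optimal k A}"
proof -
  define BB where "BB = ball (Suc m) R"
  define N where "N = card (Pow BB \<times> Pow BB)"
  have "finite BB" unfolding BB_def by (rule finite_ball[OF finite_R])
  then have finBB: "finite (Pow BB \<times> Pow BB)" by simp
  have bound: "card {k. k < n \<and> (\<exists>A. optimal k A)} \<le> N" for n
  proof -
    obtain F where F': "F \<subseteq> (\<Union>l<n. Collect (optimal l)) \<and> (\<forall>A\<in>F. \<forall>B\<in>F. nested_in V A B) \<and>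
      invariant F \<and> (\<forall>l<n. (\<exists>A. optimal l A) \<longrightarrow> (\<exists>A\<in>F. optimal l A))"
      using nested_family[of n] by (elim exE)
    have F: "F \<subseteq> (\<Union>l<n. Collect (optimal l))" "\<And>A B. A \<in> F \<Longrightarrow> B \<in> F \<Longrightarrow> nested_in V A B"
      "invariant F" "\<And>l. l < n \<Longrightarrow> \<exists>A. optimal l A \<Longrightarrow> \<exists>A\<in>F. optimal l A"
      using F' by simp_all
    have tF: "tight A \<and> card (bdry A) \<le> n" if "A \<in> F" for A
      using that F(1) optimal_tight optimal_card by fastforce
    have ex: "\<exists>A U. A \<in> F \<and> card (bdry A) = k \<and> U \<subseteq> BB \<and> trace_maximal F U A" 
      if k: "k < n" "\<exists>A. optimal k A" for k
    proof -
      obtain A where A: "A \<in> F" "optimal k A" using F(4)[OF k] by blast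
      obtain vs where vs: "short_closed m vs" "trace_maximal F (set vs) A"
        using exists_trace_maximal[OF tF F(2) A(1)] by blast
      have AV: "A \<subseteq> V" using A optimal_subset by auto
      have vsne: "vs \<noteq> []" "successively nb vs" "length vs \<le> Suc m" using vs(1) unfolding short_closed_def by auto
      obtain a b where ab: "(a, b) \<in> bdry A" "a \<in> set vs" "b \<in> set vs" 
        using vs(2) unfolding trace_maximal_def by blast
      then have "a \<in> V" "nb a b" using AV unfolding bdry_def by auto
      have vsV: "set vs \<subseteq> V"
        using walk_subset_ball[OF vsne(2) ab(2), of V] \<open>a \<in> V\<close> ball_V by auto
      obtain g where g: "aut g" "g a \<in> R" using R_meets \<open>a \<in> V\<close> by blast
      have gnb: "nb (g u) (g v) \<longleftrightarrow> nb u v" if "u \<in> V" "v \<in> V" for u v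
        using that g(1) unfolding aut_def by auto
      have inj: "inj_on g V" using g(1) unfolding aut_def bij_betw_def by auto
      have "successively nb (map g vs)"
        unfolding successively_map
        by (rule successively_mono[OF vsne(2)]) (use gnb vsV in blast)
      then have "set (map g vs) \<subseteq> ball (length (map g vs)) R"
        using ab(2) g(2) by (intro walk_subset_ball[of _ "g a"]) auto
      then have "g ` set vs \<subseteq> BB" using ball_mono2[of "length vs" "Suc m" R] vsne(3) unfolding BB_def by auto
      moreover have "g ` A \<in> F" using F(3) g(1) A(1) unfolding invariant_def by blast
      moreover have "card (bdry (g ` A)) = k" using card_bdry_image[OF g(1) AV] optimal_card[OF A(2)] by simp
      moreover have "trace_maximal F (g ` set vs) (g ` A)"
        unfolding trace_maximal_def
      proof (intro conjI ballI impI notI)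
        assume "bdry (g ` A) \<inter> g ` set vs \<times> g ` set vs = {}"
        moreover have "map_prod g g (a, b) \<in> bdry (g ` A)" unfolding bdry_image[OF g(1) AV] using ab(1) by blast
        ultimately show False using ab(2,3) by auto
      next
        fix D assume D: "D \<in> F" "g ` A \<subset> D" "D \<inter> g ` set vs = g ` A \<inter> g ` set vs"
        define D' where "D' = inv_into V g ` D"
        have D': "D' \<in> F" using F(3) aut_inv[OF g(1)] D(1) unfolding invariant_def D'_def by blast
        have DV: "D \<subseteq> V" "D' \<subseteq> V" using tF D(1) D' unfolding tight_def by auto
        have eq: "g ` D' = D" using aut_inv_image(1)[OF g(1) DV(1)] unfolding D'_def .
        have "A \<subset> D'"
        proof -
          have "inv_into V g ` g ` A \<subseteq> D'" unfolding D'_def using D(2) by blast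
          then show ?thesis using aut_inv_image(2)[OF g(1) AV] D(2) eq by auto
        qed
        moreover have "D' \<inter> set vs = A \<inter> set vs"
        proof -
          have "g ` (D' \<inter> set vs) = g ` (A \<inter> set vs)"
            using D(3) eq inj_on_image_Int[OF inj DV(2) vsV] inj_on_image_Int[OF inj AV vsV] by simp
          then show ?thesis using inj_on_image_eq_iff[OF inj, of "D' \<inter> set vs" "A \<inter> set vs"] vsV by blast
        qed
        ultimately show False using vs(2) D' unfolding trace_maximal_def by blast
      qed
      ultimately show ?thesis by blast
    qed
    then obtain fA fU where f: "\<And>k. k < n \<Longrightarrow> \<exists>A. optimal k A \<Longrightarrow>
      fA k \<in> F \<and> card (bdry (fA k)) = k \<and> fU k \<subseteq> BB \<and> trace_maximal F (fU k) (fA k)" by metis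
    let ?K = "{k. k < n \<and> (\<exists>A. optimal k A)}"
    \<comment> \<open>The trace determines the cut, and the cut its order.\<close>
    have "inj_on (\<lambda>k. (fU k, fA k \<inter> fU k)) ?K"
    proof (rule inj_onI)
      fix k l assume kl: "k \<in> ?K" "l \<in> ?K" "(fU k, fA k \<inter> fU k) = (fU l, fA l \<inter> fU l)"
      have fk: "fA k \<in> F" "card (bdry (fA k)) = k" "trace_maximal F (fU k) (fA k)" using f[of k] kl(1) by simp_all
      have fl: "fA l \<in> F" "card (bdry (fA l)) = l" "trace_maximal F (fU l) (fA l)" using f[of l] kl(2) by simp_all
      have eq: "fU k = fU l" "fA k \<inter> fU k = fA l \<inter> fU k" using kl(3) by auto
      have "fA k = fA l"
        using trace_maximal_unique[OF fk(1) fl(1) fk(3) _ eq(2)] fl(3) eq(1) F(2)[OF fk(1) fl(1)] by simp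
      then show "k = l" using fk(2) fl(2) by metis
    qed
    moreover have "(\<lambda>k. (fU k, fA k \<inter> fU k)) ` ?K \<subseteq> Pow BB \<times> Pow BB" 
    proof (rule image_subsetI)
      fix k assume "k \<in> ?K"
      then have "fU k \<subseteq> BB" using f[of k] by simp
      then show "(fU k, fA k \<inter> fU k) \<in> Pow BB \<times> Pow BB" by blast
    qed
    ultimately show ?thesis unfolding N_def by (rule card_inj_on_le) (rule finBB)
  qed
  show ?thesis
  proof (rule ccontr)
    assume "infinite {k. \<exists>A. optimal k A}"
    \<comment> \<open>\<open>Suc N\<close> many orders already lie below a single \<open>n\<close>,
      so one nested family suffices for the contradiction.\<close>
    then obtain K where K: "K \<subseteq> {k. \<exists>A. optimal k A}" "finite K" "card K = Suc N"
      using infinite_arbitrarily_large by blast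
    have "K \<subseteq> {k. k < Suc (Max K) \<and> (\<exists>A. optimal k A)}" using K by (auto simp: less_Suc_eq_le)
    then have "card K \<le> N" using bound[of "Suc (Max K)"] card_mono[of "{k. k < Suc (Max K) \<and> (\<exists>A. optimal k A)}" K] by auto
    then show False using K by simp
  qed
qed

end

section \<open>The local covering\<close>

lemma drev_drev [simp]: "drev (drev d) = d"
  by (simp add: drev_def)

lemma fst_drev [simp]: "fst (drev d) = fst d"
  by (simp add: drev_def)

lemma dstart_drev [simp]: "dstart s t (drev d) = dend s t d"
  and dend_drev [simp]: "dend s t (drev d) = dstart s t d"
  by (simp_all add: drev_def dstart_def dend_def)

lemma walk_rev_simps [simp]:
  "walk_rev [] = []" "walk_rev (d # W) = walk_rev W @ [drev d]"
  "walk_rev (U @ W) = walk_rev W @ walk_rev U" "walk_rev (walk_rev W) = W"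
  by (simp_all add: walk_rev_def rev_map comp_def)

lemma homotopic_refl [simp]: "homotopic a a"
  unfolding homotopic_def equivclp_def by simp

lemma homotopic_sym: "homotopic a b \<Longrightarrow> homotopic b a"
  unfolding homotopic_def by (rule equivclp_sym)

lemma homotopic_trans: "homotopic a b \<Longrightarrow> homotopic b c \<Longrightarrow> homotopic a c"
  unfolding homotopic_def equivclp_def by (rule rtranclp_trans)

lemma homotopic_step: "backtrack_step a b \<Longrightarrow> homotopic a b"
  unfolding homotopic_def equivclp_def by (rule r_into_rtranclp) (simp add: symclp_def)

lemma homotopic_map:
  assumes "\<And>a b. backtrack_step a b \<Longrightarrow> backtrack_step (f a) (f b)" "homotopic a b"
  shows "homotopic (f a) (f b)"
  using assms(2) unfolding homotopic_def
proof (induction rule: equivclp_induct)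
  case base
  show ?case using homotopic_refl unfolding homotopic_def .
next
  case (step y z)
  have "homotopic (f y) (f z)"
    using step.hyps(2) assms(1) homotopic_step homotopic_sym by blast
  then show ?case using step.IH homotopic_trans unfolding homotopic_def by blast
qed

lemma homotopic_context: "homotopic a b \<Longrightarrow> homotopic (p @ a @ q) (p @ b @ q)"
proof (rule homotopic_map[of "\<lambda>x. p @ x @ q"])
  fix a b :: "('a \<times> bool) list" assume "backtrack_step a b"
  then obtain p' q' d where "a = p' @ [d, drev d] @ q'" "b = p' @ q'" unfolding backtrack_step_def by blast
  then show "backtrack_step (p @ a @ q) (p @ b @ q)"
    unfolding backtrack_step_def by (intro exI[of _ "p @ p'"] exI[of _ "q' @ q"] exI[of _ d]) simp
qed

lemma homotopic_rev_Nil: "homotopic (W @ walk_rev W) []"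
proof (induction W)
  case (Cons d W)
  have "homotopic ([d] @ (W @ walk_rev W) @ [drev d]) ([d] @ [] @ [drev d])"
    by (rule homotopic_context[OF Cons.IH])
  moreover have "homotopic [d, drev d] []"
    by (intro homotopic_step[unfolded backtrack_step_def] exI[of _ "[]"] exI[of _ d]) simp
  ultimately show ?case using homotopic_trans by fastforce
qed simp

lemma homotopic_cancel: "homotopic (p @ W @ walk_rev W @ q) (p @ q)"
  using homotopic_context[OF homotopic_rev_Nil, of p W q] by simp

lemma homotopic_cancel': "homotopic (p @ walk_rev W @ W @ q) (p @ q)"
  using homotopic_cancel[of p "walk_rev W" q] by simp

text \<open>The partial reduction of a word, kept as a stack (last letter first). Intermediate words of a
  homotopy need not be walks, so invariants of walks are transported through the normal form.\<close>
definition push :: "'e dart \<Rightarrow> 'e dart list \<Rightarrow> 'e dart list" where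
  "push d st = (if st \<noteq> [] \<and> hd st = drev d then tl st else d # st)"

definition reduced :: "'e dart list \<Rightarrow> bool" where
  "reduced = successively (\<lambda>a b. b \<noteq> drev a)"

definition reduction :: "'e dart list \<Rightarrow> 'e dart list" where
  "reduction W = fold push W []"

lemma reduced_push: "reduced st \<Longrightarrow> reduced (push d st)"
  unfolding reduced_def push_def by (cases st) (auto simp: successively_Cons)

lemma reduced_fold_push: "reduced st \<Longrightarrow> reduced (fold push W st)"
  by (induction W arbitrary: st) (auto simp: reduced_push)

lemma push_drev:
  assumes "reduced st" shows "push (drev d) (push d st) = st"
proof (cases "st \<noteq> [] \<and> hd st = drev d")
  case True
  then obtain st' where st: "st = drev d # st'" by (cases st) auto
  then have "st' = [] \<or> hd st' \<noteq> d" using assms by (auto simp: reduced_def successively_Cons)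
  then show ?thesis unfolding st push_def by auto
next
  case False
  then show ?thesis unfolding push_def by auto
qed

text \<open>Pushing a dart and then its reverse restores a reduced stack, so deleting a backtrack
  anywhere does not affect the remaining computation.\<close>

lemma reduction_homotopic: "homotopic a b \<Longrightarrow> reduction a = reduction b"
proof -
  have step: "reduction a = reduction b" if "backtrack_step a b" for a b :: "'e dart list"
  proof -
    obtain p q d where ab: "a = p @ [d, drev d] @ q" "b = p @ q" using \<open>backtrack_step a b\<close> unfolding backtrack_step_def by blast
    have "reduced (fold push p [])" by (rule reduced_fold_push) (simp add: reduced_def)
    then show ?thesis unfolding ab reduction_def by (simp add: push_drev)
  qed
  assume "homotopic a b"
  then show ?thesis unfolding homotopic_def
    by (induction rule: equivclp_induct) (use step in auto)
qed

lemma is_walk_append: "is_walk V E s t x (U @ W) z \<longleftrightarrow> (\<exists>y. is_walk V E s t x U y \<and> is_walk V E s t y W z)"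
proof (induction U arbitrary: x)
  case Nil
  have "is_walk V E s t x W z \<Longrightarrow> x \<in> V" by (cases W) auto
  then show ?case by auto
qed auto

lemma is_walk_end: "is_walk V E s t x W y \<Longrightarrow> y \<in> V"
  by (induction W arbitrary: x) auto

lemma is_walk_unique: "is_walk V E s t x W y \<Longrightarrow> is_walk V E s t x W z \<Longrightarrow> y = z"
  by (induction W arbitrary: x) auto

lemma dend_in: "wf_graph V E s t \<Longrightarrow> fst d \<in> E \<Longrightarrow> dend s t d \<in> V"
  unfolding wf_graph_def dend_def by simp

lemma dstart_in: "wf_graph V E s t \<Longrightarrow> fst d \<in> E \<Longrightarrow> dstart s t d \<in> V"
  unfolding wf_graph_def dstart_def by simp

lemma is_walk_rev:
  assumes "wf_graph V E s t" shows "is_walk V E s t x W y \<Longrightarrow> is_walk V E s t y (walk_rev W) x"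
proof (induction W arbitrary: x)
  case (Cons d W)
  then have "is_walk V E s t y (walk_rev W) (dend s t d)" by auto
  moreover have "is_walk V E s t (dend s t d) [drev d] x" using Cons.prems dend_in[OF assms, of d] by auto
  ultimately show ?case using is_walk_append[of V E s t y "walk_rev W"] by auto
qed auto

lemma reach_avoid_walk:
  assumes "wf_graph V E s t" "reach_avoid V E s t {} x y" shows "\<exists>W. is_walk V E s t x W y"
proof -
  have "(\<lambda>a b. a \<in> V - {} \<and> b \<in> V - {} \<and> adj V E s t a b)\<^sup>*\<^sup>* x y" and "x \<in> V"
    using assms(2) unfolding reach_avoid_def by auto
  then show ?thesis
  proof (induction rule: rtranclp_induct)
    case base
    then have "is_walk V E s t x [] x" by simp
    then show ?case ..
  next
    case (step y z)
    then obtain W where W: "is_walk V E s t x W y" by blast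
    obtain e where e: "e \<in> E" "s e = y \<and> t e = z \<or> s e = z \<and> t e = y" and "y \<in> V" "z \<in> V"
      using step.hyps unfolding adj_def by blast
    have "is_walk V E s t y [(e, s e = y \<and> t e = z)] z"
      using e \<open>y \<in> V\<close> \<open>z \<in> V\<close> by (auto simp: dstart_def dend_def)
    then have "is_walk V E s t x (W @ [(e, s e = y \<and> t e = z)]) z" using W is_walk_append by metis
    then show ?case ..
  qed
qed

section \<open>The covering as classes of walks\<close>

locale local_cover =
  fixes V :: "'v set" and E :: "'e set" and s t :: "'e \<Rightarrow> 'v" and x0 :: 'v and r :: nat
  assumes wf: "wf_graph V E s t" and x0: "x0 \<in> V"
begin

abbreviation wk where "wk \<equiv> is_walk V E s t"
abbreviation PI where "PI \<equiv> pi1r V E s t x0 r"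
abbreviation cls where "cls \<equiv> cover_class V E s t x0 r"
abbreviation CV where "CV \<equiv> cover_V V E s t x0 r"

lemmas wk_append = is_walk_append[of V E s t]
lemmas wk_rev = is_walk_rev[OF wf]

lemma wk_appendI: "wk x U y \<Longrightarrow> wk y W z \<Longrightarrow> wk x (U @ W) z"
  using wk_append by blast

lemma wk_dart: "fst d \<in> E \<Longrightarrow> wk (dstart s t d) [d] (dend s t d)"
  using dstart_in[OF wf] dend_in[OF wf] by simp

lemma PI_walk: "W \<in> PI \<Longrightarrow> wk x0 W x0"
proof (induction rule: pi1r.induct)
  case (gen W0 y Q)
  then have "wk y Q y" unfolding cycle_walk_def by blast
  then show ?case using gen(1) wk_rev[OF gen(1)] by (intro wk_appendI)
qed (auto intro: wk_rev wk_appendI)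

lemma PI_homotopic: "W \<in> PI \<Longrightarrow> wk x0 W' x0 \<Longrightarrow> homotopic W' W \<Longrightarrow> W' \<in> PI"
  by (rule pi1r.htpy) (auto intro: homotopic_sym)

lemma PI_trivial: "wk x0 W x0 \<Longrightarrow> homotopic W [] \<Longrightarrow> W \<in> PI"
  by (rule PI_homotopic[OF pi1r.triv[OF x0]])

definition rel where
  "rel W W' \<longleftrightarrow> (\<exists>y. wk x0 W y \<and> wk x0 W' y \<and> W @ walk_rev W' \<in> PI)"

lemma cls_rel: "cls W = {W'. rel W W'}"
  unfolding cover_class_def rel_def ..

lemma rel_refl: "wk x0 W y \<Longrightarrow> rel W W"
  unfolding rel_def
  by (intro exI[of _ y] conjI PI_trivial homotopic_rev_Nil) (auto intro: wk_appendI wk_rev)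

lemma rel_sym: "rel W W' \<Longrightarrow> rel W' W"
  unfolding rel_def using pi1r.inv[of "W @ walk_rev W'" V E s t x0 r for W W'] by fastforce

lemma rel_trans:
  assumes "rel W W'" "rel W' W''" shows "rel W W''"
proof -
  obtain y where y: "wk x0 W y" "wk x0 W' y" "W @ walk_rev W' \<in> PI" using assms(1) rel_def by blast
  have y': "wk x0 W'' y" "W' @ walk_rev W'' \<in> PI"
    using assms(2) is_walk_unique[OF y(2)] unfolding rel_def by auto
  have "(W @ walk_rev W') @ (W' @ walk_rev W'') \<in> PI" by (rule pi1r.mult[OF y(3) y'(2)])
  moreover have "homotopic (W @ walk_rev W'') ((W @ walk_rev W') @ (W' @ walk_rev W''))"
    using homotopic_sym[OF homotopic_cancel'[of W W' "walk_rev W''"]] by simp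
  moreover have "wk x0 (W @ walk_rev W'') x0" using y(1) wk_rev[OF y'(1)] by (rule wk_appendI)
  ultimately have "W @ walk_rev W'' \<in> PI" using PI_homotopic by blast
  then show ?thesis using y(1) y'(1) unfolding rel_def by blast
qed

lemma cls_eqI: "rel W W' \<Longrightarrow> cls W = cls W'"
  unfolding cls_rel using rel_sym rel_trans by blast

text \<open>The walk hypothesis excludes words that are not walks from \<open>x0\<close>: they all
  have the empty class without being related.\<close>

lemma cls_eq: "wk x0 W y \<Longrightarrow> cls W = cls W' \<longleftrightarrow> rel W W'"
proof
  assume W: "wk x0 W y"
  assume "cls W = cls W'"
  then show "rel W W'" using rel_refl[OF W] rel_sym unfolding cls_rel by blast
qed (rule cls_eqI)

lemma rel_homotopic: 
  assumes "wk x0 W y" "wk x0 W' y" "homotopic W W'" shows "rel W W'"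
proof -
  have "homotopic (W @ walk_rev W') (W' @ walk_rev W')"
    using homotopic_context[OF assms(3), of "[]" "walk_rev W'"] by simp
  then have "homotopic (W @ walk_rev W') []" using homotopic_rev_Nil homotopic_trans by blast
  then have "W @ walk_rev W' \<in> PI" using PI_trivial wk_appendI[OF assms(1) wk_rev[OF assms(2)]] by blast
  then show ?thesis using assms unfolding rel_def by blast
qed

lemma rel_append:
  assumes "rel W W'" "wk x0 W y" "wk y U z" shows "rel (W @ U) (W' @ U)"
proof -
  have y: "wk x0 W' y" "W @ walk_rev W' \<in> PI"
    using assms(1) is_walk_unique[OF assms(2)] unfolding rel_def by auto
  have w: "wk x0 (W @ U) z" "wk x0 (W' @ U) z" using assms y wk_appendI by blast+
  have "homotopic ((W @ U) @ walk_rev (W' @ U)) (W @ walk_rev W')"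
    using homotopic_cancel[of W U "walk_rev W'"] by simp
  then have "(W @ U) @ walk_rev (W' @ U) \<in> PI"
    using PI_homotopic[OF y(2)] wk_appendI[OF w(1) wk_rev[OF w(2)]] by blast
  then show ?thesis using w unfolding rel_def by blast
qed

lemma rel_PI: 
  assumes "L \<in> PI" "wk x0 W y" shows "rel (L @ W) W"
proof -
  have w: "wk x0 (L @ W) y" using PI_walk[OF assms(1)] assms(2) by (rule wk_appendI)
  have "homotopic ((L @ W) @ walk_rev W) L"
    using homotopic_cancel[of L W "[]"] by simp
  then have "(L @ W) @ walk_rev W \<in> PI"
    using PI_homotopic[OF assms(1)] wk_appendI[OF w wk_rev[OF assms(2)]] by blast
  then show ?thesis using w assms unfolding rel_def by blast
qed

lemma rel_backtrack: 
  assumes "wk x0 W y" "fst d \<in> E" "dstart s t d = y" shows "rel (W @ [d, drev d]) W"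
proof (rule rel_homotopic)
  have "wk y [d] (dend s t d)" using wk_dart[OF assms(2)] assms(3) by simp
  moreover have "wk (dend s t d) [drev d] y" using wk_dart[of "drev d"] assms by simp
  ultimately have "wk y ([d] @ [drev d]) y" by (rule wk_appendI)
  then show "wk x0 (W @ [d, drev d]) y" using assms(1) wk_appendI by simp
  show "homotopic (W @ [d, drev d]) W" using homotopic_cancel[of W "[d]" "[]"] by simp
qed (rule assms)

text \<open>Adjacency in the cover, obtained by extending a walk by one dart of either direction;
  \<open>cover_adj\<close> identifies it with \<open>adj\<close>.\<close>

definition cnb :: "'e dart list set \<Rightarrow> 'e dart list set \<Rightarrow> bool" where
  "cnb X Y \<longleftrightarrow> (\<exists>W d. wk x0 W (dstart s t d) \<and> fst d \<in> E \<and> X = cls W \<and> Y = cls (W @ [d]))"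

lemma cnbI: "wk x0 W (dstart s t d) \<Longrightarrow> fst d \<in> E \<Longrightarrow> cnb (cls W) (cls (W @ [d]))"
  unfolding cnb_def by blast

lemma in_CV: "wk x0 W y \<Longrightarrow> cls W \<in> CV"
  unfolding cover_V_def by blast

lemma CV_E: assumes "X \<in> CV" obtains W y where "X = cls W" "wk x0 W y"
  using assms unfolding cover_V_def by blast

lemma cnb_sym: assumes "cnb X Y" shows "cnb Y X"
proof -
  obtain W d where W: "wk x0 W (dstart s t d)" "fst d \<in> E" "X = cls W" "Y = cls (W @ [d])"
    using assms unfolding cnb_def by blast
  have w: "wk x0 (W @ [d]) (dend s t d)" using W(1) wk_dart[OF W(2)] by (rule wk_appendI)
  have "cls ((W @ [d]) @ [drev d]) = cls W"
    using cls_eqI[OF rel_backtrack[OF W(1,2) refl]] by simp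
  then show ?thesis using cnbI[of "W @ [d]" "drev d"] w W by simp
qed

lemma cnb_in: "cnb X Y \<Longrightarrow> X \<in> CV"
  unfolding cnb_def using in_CV by blast

text \<open>\<open>cover_tgt\<close> extends an arbitrary representative; \<open>rel_append\<close>
  makes the resulting class independent of it.\<close>

lemma cover_tgt_cls:
  assumes "wk x0 W (s e)" "e \<in> E"
  shows "cover_tgt V E s t x0 r (cls W, e) = cls (W @ [(e, True)])"
proof -
  let ?W = "SOME W'. W' \<in> cls W"
  have "W \<in> cls W" using rel_refl[OF assms(1)] unfolding cls_rel by simp
  then have "rel W ?W" using someI[of "\<lambda>W'. W' \<in> cls W"] unfolding cls_rel by blast
  moreover have "wk (s e) [(e, True)] (t e)" using wk_dart[of "(e, True)"] assms(2) by (simp add: dstart_def dend_def)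
  ultimately have "rel (W @ [(e, True)]) (?W @ [(e, True)])" using rel_append assms(1) by blast
  then show ?thesis using cls_eqI unfolding cover_tgt_def by simp
qed

lemma cover_adj: "adj CV (cover_E V E s t x0 r) cover_src (cover_tgt V E s t x0 r) = cnb"
proof (intro ext iffI)
  fix X Y
  have edge: "cnb X Y" if xe: "xe \<in> cover_E V E s t x0 r" "cover_src xe = X" "cover_tgt V E s t x0 r xe = Y" for xe X Y
  proof -
    obtain e where e: "xe = (X, e)" "X \<in> CV" "e \<in> E" "\<exists>W\<in>X. wk x0 W (s e)"
      using xe(1,2) unfolding cover_E_def cover_src_def by force
    then obtain W where W: "W \<in> X" "wk x0 W (s e)" by blast
    obtain W1 y where "X = cls W1" "wk x0 W1 y" using e(2) by (rule CV_E)
    then have "X = cls W" using W(1) cls_eq[of W1 y W] unfolding cls_rel by blast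
    then show ?thesis using cnbI[of W "(e, True)"] W(2) e(1,3) xe(3) cover_tgt_cls[OF W(2) e(3)]
      by (simp add: dstart_def)
  qed
  {
    assume "adj CV (cover_E V E s t x0 r) cover_src (cover_tgt V E s t x0 r) X Y"
    then show "cnb X Y" unfolding adj_def using edge cnb_sym by blast
  next
    assume XY: "cnb X Y"
    have in2: "X \<in> CV" "Y \<in> CV" using XY cnb_in cnb_sym by blast+
    have mem: "(cls W, e) \<in> cover_E V E s t x0 r" if "wk x0 W (s e)" "e \<in> E" for W e
      using that in_CV[OF that(1)] rel_refl[OF that(1)] unfolding cover_E_def cls_rel by blast
    obtain W e b where W: "wk x0 W (dstart s t (e, b))" "e \<in> E" "X = cls W" "Y = cls (W @ [(e, b)])"
      using XY unfolding cnb_def by (metis fst_conv surj_pair)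
    show "adj CV (cover_E V E s t x0 r) cover_src (cover_tgt V E s t x0 r) X Y"
    proof (cases b)
      case True
      then have w: "wk x0 W (s e)" using W(1) by (simp add: dstart_def)
      then show ?thesis using mem[OF w W(2)] cover_tgt_cls[OF w W(2)] W True in2
        unfolding adj_def cover_src_def by (metis fst_conv)
    next
      case False
      \<comment> \<open>For a backward dart the cover edge starts at \<open>Y\<close>; following it
        undoes the last step, so it ends at \<open>X\<close>.\<close>
      then have b: "(e, b) = drev (e, True)" by (simp add: drev_def)
      have w: "wk x0 (W @ [(e, b)]) (s e)"
        using wk_appendI[OF W(1) wk_dart[of "(e, b)"]] W(2) False by (simp add: dend_def)
      have "cls ((W @ [(e, b)]) @ [(e, True)]) = X"
        using cls_eqI[OF rel_backtrack[OF W(1) _ refl]] W(2,3) b by simp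
      then show ?thesis using mem[OF w W(2)] cover_tgt_cls[OF w W(2)] W in2
        unfolding adj_def cover_src_def by (metis fst_conv)
    qed
  }
qed

section \<open>Parity along lifted walks, and the coboundary property of the cover\<close>

primrec lift_parity where
  "lift_parity P W [] = False"
| "lift_parity P W (d # U) = (((cls W, cls (W @ [d])) \<in> P) \<noteq> lift_parity P (W @ [d]) U)"

lemma lift_parity_append: "lift_parity P W (U @ U') = (lift_parity P W U \<noteq> lift_parity P (W @ U) U')"
  by (induction U arbitrary: W) auto

lemma lift_parity_cong:
  "rel W W' \<Longrightarrow> wk x0 W y \<Longrightarrow> wk y U z \<Longrightarrow> lift_parity P W U = lift_parity P W' U"
proof (induction U arbitrary: W W' y)
  case (Cons d U)
  have d: "fst d \<in> E" "dstart s t d = y" "wk (dend s t d) U z" using Cons.prems(3) by auto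
  have wd: "wk y [d] (dend s t d)" using wk_dart d by blast
  have w: "wk x0 (W @ [d]) (dend s t d)" using Cons.prems(2) wd by (rule wk_appendI)
  have rel: "rel (W @ [d]) (W' @ [d])" using rel_append Cons.prems(1,2) wd by blast
  have "cls W = cls W'" "cls (W @ [d]) = cls (W' @ [d])"
    using cls_eq[OF Cons.prems(2)] cls_eq[OF w] Cons.prems(1) rel by auto
  then show ?case using Cons.IH[OF rel w d(3)] by simp
qed simp

text \<open>Unlike the words inside a homotopy, the stacks arising from a walk are again walks (read
  backwards). A cancellation removes a step of the lift together with its reverse, and symmetry of
  \<open>P\<close> makes the two contribute evenly.\<close>

lemma reduction_walk:
  assumes P: "sym P" and U: "wk x0 U y"
  shows "wk x0 (rev (reduction U)) y \<and> rel (rev (reduction U)) U \<and>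
    lift_parity P [] (rev (reduction U)) = lift_parity P [] U"
  using U
proof (induction U arbitrary: y rule: rev_induct)
  case Nil
  then have "rel [] []" by (rule rel_refl)
  then show ?case using Nil x0 by (simp add: reduction_def)
next
  case (snoc d U)
  obtain z where z: "wk x0 U z" "wk z [d] y" using snoc.prems wk_append by blast
  have d: "fst d \<in> E" "dstart s t d = z" "dend s t d = y" using z(2) by auto
  define st where "st = reduction U"
  have IH: "wk x0 (rev st) z" "rel (rev st) U" "lift_parity P [] (rev st) = lift_parity P [] U"
    using snoc.IH[OF z(1)] unfolding st_def by auto
  have red: "reduction (U @ [d]) = push d st" unfolding reduction_def st_def by simp
  have rel: "rel (rev st @ [d]) (U @ [d])" using rel_append[OF IH(2,1) z(2)] .
  have eq: "cls (rev st) = cls U" "cls (rev st @ [d]) = cls (U @ [d])"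
    using cls_eq[OF IH(1)] IH(2) cls_eq[OF wk_appendI[OF IH(1) z(2)]] rel by auto
  show ?case
  proof (cases "st \<noteq> [] \<and> hd st = drev d")
    case False
    then have "push d st = d # st" unfolding push_def by auto
    then show ?thesis
      unfolding red using wk_appendI[OF IH(1) z(2)] rel eq IH(3) by (simp add: lift_parity_append)
  next
    case True
    then obtain st' where st': "st = drev d # st'" by (cases st) auto
    then have red': "reduction (U @ [d]) = st'" unfolding red push_def by simp
    have w: "wk x0 (rev st') y" 
      using IH(1) d wk_append[of x0 "rev st'" "[drev d]" z] unfolding st' by auto
    have "rel (rev st' @ [drev d, drev (drev d)]) (rev st')"
      using rel_backtrack[OF w, of "drev d"] d by simp
    then have r1: "rel (rev st @ [d]) (rev st')" unfolding st' by simp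
    then have r2: "rel (rev st') (U @ [d])" using rel rel_sym rel_trans by blast
    have c: "cls (rev st') = cls (U @ [d])" using cls_eq[OF w] r2 by blast
    have "lift_parity P [] U = (lift_parity P [] (rev st') \<noteq> ((cls (rev st'), cls (rev st)) \<in> P))"
      using IH(3) unfolding st' by (simp add: lift_parity_append)
    moreover have "((cls (rev st'), cls (rev st)) \<in> P) = ((cls U, cls (U @ [d])) \<in> P)"
      unfolding c eq using P by (meson symD)
    ultimately have "lift_parity P [] (rev st') = lift_parity P [] (U @ [d])"
      by (auto simp: lift_parity_append)
    then show ?thesis unfolding red' using w r2 by blast
  qed
qed

lemma lift_parity_homotopic:
  assumes "sym P" "wk x0 U y" "wk x0 U' y'" "homotopic U U'"
  shows "lift_parity P [] U = lift_parity P [] U'"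
  using reduction_walk[OF assms(1,2)] reduction_walk[OF assms(1,3)] reduction_homotopic[OF assms(4)] by simp

primrec lift where
  "lift W [] = [cls W]"
| "lift W (d # U) = cls W # lift (W @ [d]) U"

lemma lift_hd: "\<exists>Xs. lift W U = cls W # Xs"
  by (cases U) auto

lemma crossing_parity_lift: "crossing_parity P (lift W U) = lift_parity P W U"
proof (induction U arbitrary: W)
  case (Cons d U)
  obtain Xs where "lift (W @ [d]) U = cls (W @ [d]) # Xs" using lift_hd by blast
  then show ?case using Cons[of "W @ [d]"] by simp
qed simp

lemma length_lift: "length (lift W U) = Suc (length U)"
  by (induction U arbitrary: W) auto

lemma last_lift: "last (lift W U) = cls (W @ U)"
proof (induction U arbitrary: W)
  case (Cons d U)
  then show ?case using lift_hd[of "W @ [d]" U] by auto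
qed simp

lemma successively_lift: "wk x0 W y \<Longrightarrow> wk y U z \<Longrightarrow> successively cnb (lift W U)"
proof (induction U arbitrary: W y)
  case (Cons d U)
  have d: "fst d \<in> E" "dstart s t d = y" "wk (dend s t d) U z" using Cons.prems(2) by auto
  have w: "wk x0 (W @ [d]) (dend s t d)" using Cons.prems(1) wk_dart[OF d(1)] d(2) wk_appendI by blast
  have "successively cnb (lift (W @ [d]) U)" using Cons.IH[OF w d(3)] .
  moreover have "cnb (cls W) (cls (W @ [d]))" using cnbI Cons.prems(1) d by blast
  ultimately show ?case using lift_hd[of "W @ [d]" U] by (auto simp: successively_Cons)
qed simp

sublocale cover: simple_graph CV cnb
  by unfold_locales (rule cnb_in, assumption, rule cnb_sym)

text \<open>A generator lifts to a path, a short closed walk and the same path back, whose two path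
  contributions cancel mod 2. Elements of \<open>PI\<close> lift to closed walks at the base vertex,
  so parity is additive on products.\<close>

lemma lift_parity_PI:
  assumes P: "sym P" and short: "\<And>vs. cover.short_closed (max 2 r) vs \<Longrightarrow> \<not> crossing_parity P vs"
  shows "L \<in> PI \<Longrightarrow> \<not> lift_parity P [] L"
proof (induction rule: pi1r.induct)
  case triv
  then show ?case by simp
next
  case (gen W0 y Q)
  have Q: "wk y Q y" using gen(2) unfolding cycle_walk_def by blast
  have w: "wk x0 (W0 @ Q) y" using gen(1) Q by (rule wk_appendI)
  \<comment> \<open>This membership is why the lift of \<open>Q\<close> starting at
    \<open>cls W0\<close> closes up.\<close>
  have "(W0 @ Q) @ walk_rev W0 \<in> PI" using pi1r.gen[OF gen(1-3)] by simp
  then have rel: "rel (W0 @ Q) W0" using w gen(1) unfolding rel_def by blast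
  then have eq: "cls (W0 @ Q) = cls W0" using cls_eq[OF w] by blast
  have "cover.short_closed (max 2 r) (lift W0 Q)"
    unfolding cover.short_closed_def
    using successively_lift[OF gen(1) Q] lift_hd[of W0 Q] length_lift[of W0 Q] last_lift[of W0 Q] gen(3) eq
    by auto
  then have "\<not> lift_parity P W0 Q" using short crossing_parity_lift by blast
  moreover have "lift_parity P (W0 @ Q) (walk_rev W0) = lift_parity P W0 (walk_rev W0)"
    using lift_parity_cong[OF rel w wk_rev[OF gen(1)]] .
  moreover have "\<not> lift_parity P [] (W0 @ walk_rev W0)"
    using lift_parity_homotopic[OF P _ _ homotopic_rev_Nil] wk_appendI[OF gen(1) wk_rev[OF gen(1)]] x0 by fastforce
  ultimately show ?case by (auto simp: lift_parity_append)
next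
  case (inv W)
  have W: "wk x0 W x0" using PI_walk[OF inv(1)] .
  have rel: "rel W []" using rel_PI[OF inv(1), of "[]" x0] x0 by simp
  have "lift_parity P W (walk_rev W) = lift_parity P [] (walk_rev W)"
    using lift_parity_cong[OF rel W wk_rev[OF W]] .
  moreover have "\<not> lift_parity P [] (W @ walk_rev W)"
    using lift_parity_homotopic[OF P _ _ homotopic_rev_Nil] wk_appendI[OF W wk_rev[OF W]] x0 by fastforce
  ultimately show ?case using inv.IH by (auto simp: lift_parity_append)
next
  case (mult W W')
  have W: "wk x0 W x0" "wk x0 W' x0" using PI_walk mult(1,2) by auto
  have rel: "rel W []" using rel_PI[OF mult(1), of "[]" x0] x0 by simp
  have "lift_parity P W W' = lift_parity P [] W'"
    using lift_parity_cong[OF rel W] .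
  then show ?case using mult.IH by (auto simp: lift_parity_append)
next
  case (htpy W W')
  then show ?case using lift_parity_homotopic[OF P PI_walk[OF htpy(1)] htpy(2,3)] by simp
qed

text \<open>\<open>S\<close> is a potential for \<open>P\<close>: the vertices reached from the base
  vertex with odd parity. It is well defined because two walks in one class differ by an element of
  \<open>PI\<close>, which has even parity.\<close>

lemma cover_coboundary:
  assumes P: "sym P" and short: "\<And>vs. cover.short_closed (max 2 r) vs \<Longrightarrow> \<not> crossing_parity P vs"
  shows "\<exists>S. \<forall>X Y. cnb X Y \<longrightarrow> ((X, Y) \<in> P \<longleftrightarrow> (X \<in> S) \<noteq> (Y \<in> S))"
proof -
  define S where "S = {cls W | W y. wk x0 W y \<and> lift_parity P [] W}"
  have S: "cls W \<in> S \<longleftrightarrow> lift_parity P [] W" if W: "wk x0 W y" for W y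
  proof
    assume "cls W \<in> S"
    then obtain W' y' where W': "cls W = cls W'" "lift_parity P [] W'" unfolding S_def by blast
    have rel: "rel W W'" using cls_eq[OF W] W'(1) by blast
    then have w': "wk x0 W' y" "W @ walk_rev W' \<in> PI" using is_walk_unique[OF W] unfolding rel_def by auto
    have "\<not> lift_parity P [] (W @ walk_rev W')" using lift_parity_PI[OF P short] w'(2) by blast
    moreover have "lift_parity P W (walk_rev W') = lift_parity P W' (walk_rev W')"
      using lift_parity_cong[OF rel W wk_rev[OF w'(1)]] .
    moreover have "\<not> lift_parity P [] (W' @ walk_rev W')"
      using lift_parity_homotopic[OF P _ _ homotopic_rev_Nil] wk_appendI[OF w'(1) wk_rev[OF w'(1)]] x0 by fastforce
    ultimately show "lift_parity P [] W" using W'(2) by (auto simp: lift_parity_append)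
  next
    assume "lift_parity P [] W"
    then show "cls W \<in> S" using W unfolding S_def by blast
  qed
  have "(X, Y) \<in> P \<longleftrightarrow> (X \<in> S) \<noteq> (Y \<in> S)" if "cnb X Y" for X Y
  proof -
    obtain W d where W: "wk x0 W (dstart s t d)" "fst d \<in> E" "X = cls W" "Y = cls (W @ [d])"
      using \<open>cnb X Y\<close> unfolding cnb_def by blast
    then show ?thesis using S[OF W(1)] S[OF wk_appendI[OF W(1) wk_dart[OF W(2)]]]
      by (auto simp: lift_parity_append)
  qed
  then show ?thesis by blast
qed

end

section \<open>From edge cuts to separations of ends\<close>

lemma adj_sym: "adj V E s t u v \<Longrightarrow> adj V E s t v u"
  unfolding adj_def by blast

lemma simple_graph_adj: "simple_graph V (adj V E s t)"
  by unfold_locales (auto simp: adj_def)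

lemma reach_avoid_in:
  assumes "reach_avoid V E s t S u v" shows "u \<in> V - S" "v \<in> V - S"
proof -
  show "u \<in> V - S" using assms unfolding reach_avoid_def by blast
  have "(\<lambda>a b. a \<in> V - S \<and> b \<in> V - S \<and> adj V E s t a b)\<^sup>*\<^sup>* u v"
    using assms unfolding reach_avoid_def by blast
  then show "v \<in> V - S" using \<open>u \<in> V - S\<close> by (induction rule: rtranclp_induct) auto
qed

lemma reach_avoid_trans:
  "reach_avoid V E s t S u v \<Longrightarrow> reach_avoid V E s t S v w \<Longrightarrow> reach_avoid V E s t S u w"
  unfolding reach_avoid_def by (meson rtranclp_trans)

lemma reach_avoid_step:
  assumes "reach_avoid V E s t S u v" "adj V E s t v w" "w \<notin> S"
  shows "reach_avoid V E s t S u w"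
proof -
  have "v \<in> V - S" "w \<in> V - S" using reach_avoid_in(2)[OF assms(1)] assms(2,3) unfolding adj_def by auto
  then have "v \<in> V - S \<and> w \<in> V - S \<and> adj V E s t v w" using assms(2) by simp
  then show ?thesis
    using assms(1) rtranclp.rtrancl_into_rtrancl[of "\<lambda>a b. a \<in> V - S \<and> b \<in> V - S \<and> adj V E s t a b" u v w]
    unfolding reach_avoid_def by simp
qed

lemma reach_avoid_refl: "u \<in> V - S \<Longrightarrow> reach_avoid V E s t S u u"
  unfolding reach_avoid_def by blast

lemma reach_avoid_sym:
  assumes "reach_avoid V E s t S u v" shows "reach_avoid V E s t S v u"
proof -
  have "(\<lambda>a b. a \<in> V - S \<and> b \<in> V - S \<and> adj V E s t a b)\<^sup>*\<^sup>* u v"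
    using assms unfolding reach_avoid_def by blast
  then have "(\<lambda>a b. a \<in> V - S \<and> b \<in> V - S \<and> adj V E s t a b)\<^sup>*\<^sup>* v u"
  proof (induction rule: rtranclp_induct)
    case (step y z)
    have "z \<in> V - S \<and> y \<in> V - S \<and> adj V E s t z y" using step.hyps(2) adj_sym[of V E s t y z] by simp
    then show ?case using step.IH by (rule converse_rtranclp_into_rtranclp)
  qed auto
  then show ?thesis using reach_avoid_in(2)[OF assms] unfolding reach_avoid_def by blast
qed

lemma ray_tail_reach:
  assumes "is_ray V E s t \<rho>" "\<forall>k\<ge>n. \<rho> k \<notin> S" "n \<le> k"
  shows "reach_avoid V E s t S (\<rho> n) (\<rho> k)"
  using assms(3)
proof (induction rule: dec_induct)
  case base
  show ?case using assms(1,2) by (intro reach_avoid_refl) (auto simp: is_ray_def)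
next
  case (step k)
  show ?case using assms step by (intro reach_avoid_step[OF step.IH]) (auto simp: is_ray_def)
qed

lemma ray_leaves_finite:
  assumes "is_ray V E s t \<rho>" "finite S"
  shows "\<exists>n. \<forall>k\<ge>n. \<rho> k \<notin> S"
proof -
  have "finite (\<rho> -` S)" using assms by (intro finite_vimageI) (auto simp: is_ray_def)
  then obtain n where "\<forall>k\<in>\<rho> -` S. k < n" using finite_nat_set_iff_bounded by blast
  then show ?thesis by (metis leD vimageI2)
qed

lemma ray_equiv_sym: "ray_equiv V E s t \<rho> \<sigma> \<Longrightarrow> ray_equiv V E s t \<sigma> \<rho>"
  unfolding ray_equiv_def using reach_avoid_sym by metis

lemma ray_equiv_trans:
  assumes "is_ray V E s t \<sigma>" "ray_equiv V E s t \<rho> \<sigma>" "ray_equiv V E s t \<sigma> \<tau>"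
  shows "ray_equiv V E s t \<rho> \<tau>"
  unfolding ray_equiv_def
proof (intro allI impI)
  fix S :: "'a set" assume S: "finite S"
  obtain n m where 1: "\<forall>k\<ge>n. \<rho> k \<notin> S" "\<forall>k\<ge>m. \<sigma> k \<notin> S" "reach_avoid V E s t S (\<rho> n) (\<sigma> m)"
    using assms(2) S unfolding ray_equiv_def by blast
  obtain n' m' where 2: "\<forall>k\<ge>n'. \<sigma> k \<notin> S" "\<forall>k\<ge>m'. \<tau> k \<notin> S" "reach_avoid V E s t S (\<sigma> n') (\<tau> m')"
    using assms(3) S unfolding ray_equiv_def by blast
  have "reach_avoid V E s t S (\<sigma> m) (\<sigma> n')"
  proof (cases "m \<le> n'")
    case True then show ?thesis using ray_tail_reach[OF assms(1) 1(2)] by blast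
  next
    case False
    then have "reach_avoid V E s t S (\<sigma> n') (\<sigma> m)" using ray_tail_reach[OF assms(1) 2(1), of m] by simp
    then show ?thesis by (rule reach_avoid_sym)
  qed
  then have "reach_avoid V E s t S (\<rho> n) (\<tau> m')" 
    using reach_avoid_trans[OF reach_avoid_trans[OF 1(3)] 2(3)] by blast
  then show "\<exists>n m. (\<forall>k\<ge>n. \<rho> k \<notin> S) \<and> (\<forall>k\<ge>m. \<tau> k \<notin> S) \<and> reach_avoid V E s t S (\<rho> n) (\<tau> m)"
    using 1(1) 2(2) by (intro exI conjI)
qed

text \<open>A cut of least size among those separating two given ends is optimal by definition, so
  the largest occurring order bounds it.\<close>

lemma accessible_of_finite_orders:
  assumes fin: "finite {k. \<exists>A. simple_graph.optimal V (adj V E s t) k A}"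
    and locally_fin: "\<And>u. finite {v. adj V E s t u v}"
  shows "accessible V E s t"
proof -
  interpret simple_graph V "adj V E s t" by (rule simple_graph_adj)
  obtain K where "\<forall>k\<in>{k. \<exists>A. optimal k A}. k \<le> K"
    using fin unfolding finite_nat_set_iff_bounded_le by (elim exE)
  then have K: "k \<le> K" if "optimal k A" for k A using that by blast
  \<comment> \<open>\<open>Field (bdry A)\<close> contains both ends of every boundary edge, so a
    path avoiding it never changes sides.\<close>
  have reach_side: "v \<in> A"
    if A: "reach_avoid V E s t (Field (bdry A)) u v" "u \<in> A" for u v A
  proof -
    have "(\<lambda>a b. a \<in> V - Field (bdry A) \<and> b \<in> V - Field (bdry A) \<and> adj V E s t a b)\<^sup>*\<^sup>* u v"
      using A(1) unfolding reach_avoid_def by blast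
    then show ?thesis
    proof (induction rule: rtranclp_induct)
      case (step y z)
      show ?case
      proof (rule ccontr)
        assume "z \<notin> A"
        then have "(y, z) \<in> bdry A" using step unfolding bdry_def by blast
        then show False using step.hyps FieldI1 by fast
      qed
    qed (rule A(2))
  qed
  have finF: "finite (Field (bdry A))" if "finite (bdry A)" for A
    using that by (rule finite_Field)
  have endlike: "endlike \<rho>" if \<rho>: "is_ray V E s t \<rho>" for \<rho>
    unfolding endlike_def
  proof (intro conjI allI impI)
    show "range \<rho> \<subseteq> V" using \<rho> unfolding is_ray_def by auto
    then have rV: "\<rho> k \<in> V" for k by auto
    fix A assume A: "A \<subseteq> V" "finite (bdry A)"
    obtain n where n: "\<forall>k\<ge>n. \<rho> k \<notin> Field (bdry A)" using ray_leaves_finite[OF \<rho> finF[OF A(2)]] by blast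
    have *: "\<rho> k \<in> A \<longleftrightarrow> \<rho> n \<in> A" if "n \<le> k" for k
      using reach_side ray_tail_reach[OF \<rho> n that] reach_avoid_sym by metis
    show "(\<forall>\<^sub>F k in sequentially. \<rho> k \<in> A) \<or> (\<forall>\<^sub>F k in sequentially. \<rho> k \<in> V - A)"
    proof (cases "\<rho> n \<in> A")
      case True
      then show ?thesis using * unfolding eventually_sequentially by blast
    next
      case False
      then show ?thesis using * rV unfolding eventually_sequentially by blast
    qed
  qed
  have equiv_side: "has_tail_in \<sigma> A"
    if A: "A \<subseteq> V" "finite (bdry A)" and \<sigma>: "is_ray V E s t \<sigma>" "ray_equiv V E s t \<rho> \<sigma>"
      and \<rho>: "is_ray V E s t \<rho>" and ev: "\<forall>\<^sub>F k in sequentially. \<rho> k \<in> A" for A \<rho> \<sigma>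
  proof -
    obtain n m where nm: "\<forall>k\<ge>n. \<rho> k \<notin> Field (bdry A)" "\<forall>k\<ge>m. \<sigma> k \<notin> Field (bdry A)"
      "reach_avoid V E s t (Field (bdry A)) (\<rho> n) (\<sigma> m)"
      using \<sigma>(2) finF[OF A(2)] unfolding ray_equiv_def by blast
    obtain l where l: "\<And>k. l \<le> k \<Longrightarrow> \<rho> k \<in> A" using ev unfolding eventually_sequentially by blast
    have "reach_avoid V E s t (Field (bdry A)) (\<rho> (max n l)) (\<rho> n)"
      by (rule reach_avoid_sym[OF ray_tail_reach[OF \<rho> nm(1)]]) simp
    then have "\<rho> n \<in> A" using reach_side l[of "max n l"] by simp
    then have "\<sigma> m \<in> A" using reach_side nm(3) by blast
    then have "\<forall>k\<ge>m. \<sigma> k \<in> A" using reach_side ray_tail_reach[OF \<sigma>(1) nm(2)] by blast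
    then show ?thesis unfolding has_tail_in_def by blast
  qed
  have sep_exists: "\<exists>A. separates A \<rho> \<sigma>"
    if \<rho>: "is_ray V E s t \<rho>" and \<sigma>: "is_ray V E s t \<sigma>" and ne: "\<not> ray_equiv V E s t \<rho> \<sigma>" for \<rho> \<sigma>
  proof -
    obtain S where S: "finite S" and no: "\<And>n m. \<forall>k\<ge>n. \<rho> k \<notin> S \<Longrightarrow> \<forall>k\<ge>m. \<sigma> k \<notin> S \<Longrightarrow>
        \<not> reach_avoid V E s t S (\<rho> n) (\<sigma> m)"
      using ne unfolding ray_equiv_def by blast
    obtain n m where n: "\<forall>k\<ge>n. \<rho> k \<notin> S" and m: "\<forall>k\<ge>m. \<sigma> k \<notin> S"
      using ray_leaves_finite[OF \<rho> S] ray_leaves_finite[OF \<sigma> S] by blast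
    \<comment> \<open>The component of the tail of \<open>\<rho>\<close> after deleting
      \<open>S\<close>. Every edge leaving it ends in \<open>S\<close>, so local finiteness makes
      the cut finite.\<close>
    define A where "A = {v. reach_avoid V E s t S (\<rho> n) v}"
    have "A \<subseteq> V" unfolding A_def using reach_avoid_in(2) by fast
    have "bdry A \<subseteq> prod.swap ` (SIGMA v:S. {u. adj V E s t v u})"
    proof (rule subrelI)
      fix u v assume uv: "(u, v) \<in> bdry A"
      then have "v \<in> S" using reach_avoid_step unfolding bdry_def A_def by fast
      then have "(v, u) \<in> (SIGMA v:S. {u. adj V E s t v u})" using uv nb_sym unfolding bdry_def by blast
      then show "(u, v) \<in> prod.swap ` (SIGMA v:S. {u. adj V E s t v u})" by force
    qed
    then have "finite (bdry A)"
      using S locally_fin by (elim finite_subset) (intro finite_imageI finite_SigmaI)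
    moreover have "\<forall>k\<ge>n. \<rho> k \<in> A" using ray_tail_reach[OF \<rho> n] unfolding A_def by blast
    moreover have "\<forall>k\<ge>m. \<sigma> k \<in> V - A"
    proof (intro allI impI)
      fix k assume "m \<le> k"
      then have "\<forall>j\<ge>k. \<sigma> j \<notin> S" using m by simp
      then have "\<sigma> k \<notin> A" using no[OF n] unfolding A_def by blast
      then show "\<sigma> k \<in> V - A" using \<sigma> unfolding is_ray_def by blast
    qed
    ultimately show ?thesis
      using \<open>A \<subseteq> V\<close> unfolding separates_def eventually_sequentially by blast
  qed
  show ?thesis
    unfolding accessible_def
  proof (intro exI[of _ K] ballI impI)
    fix \<omega>1 \<omega>2 assume w: "\<omega>1 \<in> graph_ends V E s t" "\<omega>2 \<in> graph_ends V E s t" "\<omega>1 \<noteq> \<omega>2"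
    obtain \<rho> where \<rho>: "is_ray V E s t \<rho>" "\<omega>1 = {R. is_ray V E s t R \<and> ray_equiv V E s t \<rho> R}"
      using w(1) unfolding graph_ends_def by blast
    obtain \<sigma> where \<sigma>: "is_ray V E s t \<sigma>" "\<omega>2 = {R. is_ray V E s t R \<and> ray_equiv V E s t \<sigma> R}"
      using w(2) unfolding graph_ends_def by blast
    have "\<not> ray_equiv V E s t \<rho> \<sigma>"
    proof
      assume *: "ray_equiv V E s t \<rho> \<sigma>"
      have "ray_equiv V E s t \<rho> R \<longleftrightarrow> ray_equiv V E s t \<sigma> R" for R
        using ray_equiv_trans[OF \<sigma>(1) *] ray_equiv_trans[OF \<rho>(1) ray_equiv_sym[OF *]] by blast
      then show False using w(3) \<rho>(2) \<sigma>(2) by simp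
    qed
    then obtain A0 where "separates A0 \<rho> \<sigma>" using sep_exists[OF \<rho>(1) \<sigma>(1)] by blast
    then obtain A where A: "separates A \<rho> \<sigma>" and min: "\<forall>B. separates B \<rho> \<sigma> \<longrightarrow> card (bdry A) \<le> card (bdry B)"
      using ex_has_least_nat[of "\<lambda>A. separates A \<rho> \<sigma>" A0 "\<lambda>A. card (bdry A)"] by blast
    have "optimal (card (bdry A)) A"
      unfolding optimal_def edge_conn_ge_def using A min endlike[OF \<rho>(1)] endlike[OF \<sigma>(1)] by blast
    then have le: "card (bdry A) \<le> K" by (rule K)
    have AV: "A \<subseteq> V" "finite (bdry A)" "\<forall>\<^sub>F k in sequentially. \<rho> k \<in> A" "\<forall>\<^sub>F k in sequentially. \<sigma> k \<in> V - A"
      using A unfolding separates_def by auto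
    \<comment> \<open>Adding the outer ends of the boundary edges to \<open>A\<close> turns the edge
      cut into a vertex separation whose overlap is no larger than the boundary.\<close>
    let ?A = "A \<union> snd ` bdry A" and ?B = "V - A"
    have int: "?A \<inter> ?B = snd ` bdry A" using AV(1) nb_in2 unfolding bdry_def by fastforce
    have sep: "is_separation V E s t ?A ?B"
      unfolding is_separation_def
    proof (intro conjI ballI notI)
      have "snd ` bdry A \<subseteq> V" using int by blast
      then show "?A \<union> ?B = V" using AV(1) by blast
    next
      fix e assume e: "e \<in> E" "s e \<in> ?A - ?B \<and> t e \<in> ?B - ?A"
      then have "s e \<in> A" "t e \<in> V" "s e \<in> V" "t e \<notin> A" using int AV(1) by blast+
      then have "(s e, t e) \<in> bdry A" using e(1) unfolding bdry_def adj_def by blast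
      then show False using e(2) by force
    next
      fix e assume e: "e \<in> E" "s e \<in> ?B - ?A \<and> t e \<in> ?A - ?B"
      then have "t e \<in> A" "s e \<in> V" "t e \<in> V" "s e \<notin> A" using int AV(1) by blast+
      then have "(t e, s e) \<in> bdry A" using e(1) unfolding bdry_def adj_def by blast
      then show False using e(2) by force
    qed
    have "has_tail_in R ?A" if "R \<in> \<omega>1" for R
    proof -
      have "has_tail_in R A" using equiv_side[OF AV(1,2) _ _ \<rho>(1) AV(3)] that \<rho>(2) by blast
      then show ?thesis unfolding has_tail_in_def by blast
    qed
    moreover have "has_tail_in R ?B" if "R \<in> \<omega>2" for R
      using equiv_side[OF _ finite_bdry_compl[OF AV(1,2)] _ _ \<sigma>(1) AV(4)] that \<sigma>(2) by blast
    ultimately have "distinguishes V E s t ?A ?B \<omega>1 \<omega>2"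
      using sep AV(2) unfolding distinguishes_def int by blast
    moreover have "card (?A \<inter> ?B) \<le> K" unfolding int using card_image_le[OF AV(2), of snd] le by simp
    ultimately show "\<exists>A B. distinguishes V E s t A B \<omega>1 \<omega>2 \<and> card (A \<inter> B) \<le> K" by blast
  qed
qed

section \<open>Lifting automorphisms\<close>

text \<open>\<open>is_aut\<close> respects only the unordered pair of ends, so \<open>\<psi>\<close>
  may turn an edge around, and the Boolean corrects for this. Under an automorphism, loops keep
  their direction.\<close>

definition dart_map :: "('e \<Rightarrow> 'v) \<Rightarrow> ('v \<Rightarrow> 'v) \<Rightarrow> ('e \<Rightarrow> 'e) \<Rightarrow> 'e dart \<Rightarrow> 'e dart" where
  "dart_map s \<phi> \<psi> d = (\<psi> (fst d), (s (\<psi> (fst d)) = \<phi> (s (fst d))) = snd d)"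

lemma dart_map_drev: "dart_map s \<phi> \<psi> (drev d) = drev (dart_map s \<phi> \<psi> d)"
  unfolding dart_map_def drev_def by auto

lemma walk_rev_dart_map: "walk_rev (map (dart_map s \<phi> \<psi>) W) = map (dart_map s \<phi> \<psi>) (walk_rev W)"
  by (simp add: walk_rev_def rev_map[symmetric] comp_def dart_map_drev)

lemma homotopic_dart_map:
  "homotopic U W \<Longrightarrow> homotopic (map (dart_map s \<phi> \<psi>) U) (map (dart_map s \<phi> \<psi>) W)"
proof (rule homotopic_map[of "map (dart_map s \<phi> \<psi>)"])
  fix a b :: "('a \<times> bool) list" assume "backtrack_step a b"
  then obtain p q d where "a = p @ [d, drev d] @ q" "b = p @ q" unfolding backtrack_step_def by blast
  then show "backtrack_step (map (dart_map s \<phi> \<psi>) a) (map (dart_map s \<phi> \<psi>) b)"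
    unfolding backtrack_step_def
    by (intro exI[of _ "map (dart_map s \<phi> \<psi>) p"] exI[of _ "map (dart_map s \<phi> \<psi>) q"] exI[of _ "dart_map s \<phi> \<psi> d"])
      (simp add: dart_map_drev)
qed

lemma dart_map_ends:
  assumes "is_aut V E s t \<phi> \<psi>" "fst d \<in> E"
  shows "fst (dart_map s \<phi> \<psi> d) \<in> E" "dstart s t (dart_map s \<phi> \<psi> d) = \<phi> (dstart s t d)"
    "dend s t (dart_map s \<phi> \<psi> d) = \<phi> (dend s t d)"
proof -
  have "\<psi> ` E = E" and e: "{s (\<psi> (fst d)), t (\<psi> (fst d))} = {\<phi> (s (fst d)), \<phi> (t (fst d))}"
    using assms unfolding is_aut_def bij_betw_def by auto
  then show "fst (dart_map s \<phi> \<psi> d) \<in> E" using assms(2) unfolding dart_map_def by auto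
  show "dstart s t (dart_map s \<phi> \<psi> d) = \<phi> (dstart s t d)" "dend s t (dart_map s \<phi> \<psi> d) = \<phi> (dend s t d)"
    using e unfolding dart_map_def dstart_def dend_def by (auto simp: doubleton_eq_iff)
qed

lemma dart_map_walk:
  assumes "is_aut V E s t \<phi> \<psi>"
  shows "is_walk V E s t x W y \<Longrightarrow> is_walk V E s t (\<phi> x) (map (dart_map s \<phi> \<psi>) W) (\<phi> y)"
proof (induction W arbitrary: x)
  case Nil
  then show ?case using assms unfolding is_aut_def bij_betw_def by auto
next
  case (Cons d W)
  moreover have "\<phi> x \<in> V" using assms Cons.prems unfolding is_aut_def bij_betw_def by auto
  ultimately show ?case using dart_map_ends[OF assms, of d] by auto
qed

lemma walk_darts: "is_walk V E s t x W y \<Longrightarrow> d \<in> set W \<Longrightarrow> fst d \<in> E \<and> dstart s t d \<in> V"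
  by (induction W arbitrary: x) auto

lemma dart_map_cycle:
  assumes a: "is_aut V E s t \<phi> \<psi>" and Q: "cycle_walk V E s t y Q"
  shows "cycle_walk V E s t (\<phi> y) (map (dart_map s \<phi> \<psi>) Q)"
proof -
  have w: "is_walk V E s t y Q y" and d: "Q \<noteq> []" "distinct (map fst Q)" "distinct (map (dstart s t) Q)"
    using Q unfolding cycle_walk_def by auto
  have inj: "inj_on \<psi> E" "inj_on \<phi> V" using a unfolding is_aut_def bij_betw_def by auto
  have Qd: "fst d \<in> E" "dstart s t d \<in> V" if "d \<in> set Q" for d using walk_darts[OF w that] by auto
  have "map fst (map (dart_map s \<phi> \<psi>) Q) = map \<psi> (map fst Q)" by (simp add: dart_map_def)
  moreover have "set (map fst Q) \<subseteq> E" using Qd(1) by (simp add: image_subset_iff)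
  then have "distinct (map \<psi> (map fst Q))"
    unfolding distinct_map[of \<psi>] using d(2) inj_on_subset[OF inj(1)] by blast
  moreover have "map (dstart s t) (map (dart_map s \<phi> \<psi>) Q) = map \<phi> (map (dstart s t) Q)"
    using dart_map_ends(2)[OF a] Qd by simp
  moreover have "set (map (dstart s t) Q) \<subseteq> V" using Qd(2) by (simp add: image_subset_iff)
  then have "distinct (map \<phi> (map (dstart s t) Q))"
    unfolding distinct_map[of \<phi>] using d(3) inj_on_subset[OF inj(2)] by blast
  ultimately have "distinct (map fst (map (dart_map s \<phi> \<psi>) Q))"
    "distinct (map (dstart s t) (map (dart_map s \<phi> \<psi>) Q))" by (simp_all only:)
  then show ?thesis
    using dart_map_walk[OF a w] d(1) unfolding cycle_walk_def by (simp only: map_is_Nil_conv) simp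
qed

lemma is_aut_inv:
  assumes wf: "wf_graph V E s t" and a: "is_aut V E s t \<phi> \<psi>"
  shows "is_aut V E s t (inv_into V \<phi>) (inv_into E \<psi>)"
proof -
  have b: "bij_betw \<phi> V V" "bij_betw \<psi> E E" using a unfolding is_aut_def by auto
  have "{s (inv_into E \<psi> e), t (inv_into E \<psi> e)} = {inv_into V \<phi> (s e), inv_into V \<phi> (t e)}" if "e \<in> E" for e
  proof -
    define e' where "e' = inv_into E \<psi> e"
    have e': "e' \<in> E" "\<psi> e' = e"
      using that b(2) unfolding e'_def bij_betw_def by (auto simp: inv_into_into f_inv_into_f)
    have st: "s e' \<in> V" "t e' \<in> V" using wf e'(1) unfolding wf_graph_def by auto
    have "{s e, t e} = {\<phi> (s e'), \<phi> (t e')}" using a e' unfolding is_aut_def by auto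
    then have "inv_into V \<phi> ` {s e, t e} = inv_into V \<phi> ` {\<phi> (s e'), \<phi> (t e')}" by simp
    also have "\<dots> = {s e', t e'}" using b(1) st by (simp add: bij_betw_def)
    finally show ?thesis unfolding e'_def by simp
  qed
  then show ?thesis
    unfolding is_aut_def using bij_betw_inv_into[OF b(1)] bij_betw_inv_into[OF b(2)] by (intro conjI ballI)
qed

lemma dart_map_inverse:
  assumes wf: "wf_graph V E s t" and a: "is_aut V E s t \<phi> \<psi>" and d: "fst d \<in> E"
    and inv: "\<And>v. v \<in> V \<Longrightarrow> \<phi>' (\<phi> v) = v" "\<And>e. e \<in> E \<Longrightarrow> \<psi>' (\<psi> e) = e"
  shows "dart_map s \<phi>' \<psi>' (dart_map s \<phi> \<psi> d) = d"
proof -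
  obtain e b where eb: "d = (e, b)" by (cases d)
  have e: "e \<in> E" using d eb by simp
  have st: "s e \<in> V" "t e \<in> V" using wf e unfolding wf_graph_def by auto
  have "s (\<psi> e) \<in> {\<phi> (s e), \<phi> (t e)}" using a e unfolding is_aut_def by (metis insertI1)
  then have "s (\<psi> e) = \<phi> (s e) \<longleftrightarrow> s e = \<phi>' (s (\<psi> e))"
    using inv(1) st by (metis insertE singletonD)
  then show ?thesis unfolding eb dart_map_def by (auto simp: inv(2)[OF e])
qed

lemma map_dart_map_inverse:
  assumes "wf_graph V E s t" "is_aut V E s t \<phi> \<psi>"
    and "\<And>v. v \<in> V \<Longrightarrow> \<phi>' (\<phi> v) = v" "\<And>e. e \<in> E \<Longrightarrow> \<psi>' (\<psi> e) = e"
    and W: "is_walk V E s t x W y"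
  shows "map (dart_map s \<phi>' \<psi>') (map (dart_map s \<phi> \<psi>) W) = W"
proof -
  have "dart_map s \<phi>' \<psi>' (dart_map s \<phi> \<psi> d) = d" if "d \<in> set W" for d
    using dart_map_inverse[OF assms(1,2) _ assms(3,4)] walk_darts[OF W that] by blast
  then show ?thesis by (simp add: map_idI)
qed

section \<open>Lifts of automorphisms to the cover\<close>

context local_cover begin

text \<open>With \<open>K\<close> a walk from \<open>x0\<close> to its image, this is the lift of
  the automorphism taking the base vertex to \<open>cls K\<close>; varying \<open>K\<close> varies
  the lift by deck transformations.\<close>

definition transport where
  "transport K \<phi> \<psi> X = cls (K @ map (dart_map s \<phi> \<psi>) (SOME W. W \<in> X))"

text \<open>Automorphisms preserve cycles and their lengths, and conjugation by \<open>K\<close>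
  brings the base point back, so generators go to generators. In a product the inner
  \<open>walk_rev K @ K\<close> cancels.\<close>

lemma transport_PI:
  assumes a: "is_aut V E s t \<phi> \<psi>" and K: "wk x0 K (\<phi> x0)"
  shows "L \<in> PI \<Longrightarrow> K @ map (dart_map s \<phi> \<psi>) L @ walk_rev K \<in> PI"
proof (induction rule: pi1r.induct)
  case triv
  show ?case using PI_trivial[of "K @ walk_rev K"] homotopic_rev_Nil[of K] wk_appendI[OF K wk_rev[OF K]] by simp
next
  case (gen W0 y Q)
  have "wk x0 (K @ map (dart_map s \<phi> \<psi>) W0) (\<phi> y)" using K dart_map_walk[OF a gen(1)] by (rule wk_appendI)
  then have "(K @ map (dart_map s \<phi> \<psi>) W0) @ map (dart_map s \<phi> \<psi>) Q @ walk_rev (K @ map (dart_map s \<phi> \<psi>) W0) \<in> PI"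
    by (rule pi1r.gen[OF _ dart_map_cycle[OF a gen(2)]]) (simp add: gen(3))
  then show ?case by (simp add: walk_rev_dart_map)
next
  case (inv W)
  show ?case using pi1r.inv[OF inv.IH] by (simp add: walk_rev_dart_map)
next
  case (mult W W')
  let ?m = "map (dart_map s \<phi> \<psi>)"
  have "wk x0 (W @ W') x0" using PI_walk mult(1,2) wk_appendI by blast
  then have "wk x0 (K @ ?m (W @ W') @ walk_rev K) x0"
    using wk_appendI[OF K wk_appendI[OF dart_map_walk[OF a] wk_rev[OF K]]] by blast
  moreover have "homotopic (K @ ?m (W @ W') @ walk_rev K) ((K @ ?m W @ walk_rev K) @ (K @ ?m W' @ walk_rev K))"
    using homotopic_sym[OF homotopic_cancel'[of "K @ ?m W" K "?m W' @ walk_rev K"]] by simp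
  ultimately show ?case using PI_homotopic[OF pi1r.mult[OF mult.IH]] by blast
next
  case (htpy W W')
  let ?m = "map (dart_map s \<phi> \<psi>)"
  have "wk x0 (K @ ?m W' @ walk_rev K) x0"
    using wk_appendI[OF K wk_appendI[OF dart_map_walk[OF a htpy(2)] wk_rev[OF K]]] .
  moreover have "homotopic (K @ ?m W' @ walk_rev K) (K @ ?m W @ walk_rev K)"
    by (rule homotopic_context[OF homotopic_dart_map[OF homotopic_sym[OF htpy(3)]]])
  ultimately show ?case using PI_homotopic[OF htpy.IH] by blast
qed

lemma transport_rel:
  assumes a: "is_aut V E s t \<phi> \<psi>" and K: "wk x0 K (\<phi> x0)" and rel: "rel U U'"
  shows "rel (K @ map (dart_map s \<phi> \<psi>) U) (K @ map (dart_map s \<phi> \<psi>) U')"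
proof -
  obtain y where y: "wk x0 U y" "wk x0 U' y" "U @ walk_rev U' \<in> PI" using rel unfolding rel_def by blast
  have "wk x0 (K @ map (dart_map s \<phi> \<psi>) U) (\<phi> y)" "wk x0 (K @ map (dart_map s \<phi> \<psi>) U') (\<phi> y)"
    using wk_appendI[OF K dart_map_walk[OF a]] y by blast+
  moreover have "(K @ map (dart_map s \<phi> \<psi>) U) @ walk_rev (K @ map (dart_map s \<phi> \<psi>) U') \<in> PI"
    using transport_PI[OF a K y(3)] by (simp add: walk_rev_dart_map)
  ultimately show ?thesis unfolding rel_def by blast
qed

lemma transport_cls:
  assumes a: "is_aut V E s t \<phi> \<psi>" and K: "wk x0 K (\<phi> x0)" and U: "wk x0 U y"
  shows "transport K \<phi> \<psi> (cls U) = cls (K @ map (dart_map s \<phi> \<psi>) U)"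
proof -
  have "U \<in> cls U" using rel_refl[OF U] unfolding cls_rel by simp
  then have "rel U (SOME W. W \<in> cls U)" using someI[of "\<lambda>W. W \<in> cls U"] unfolding cls_rel by blast
  then show ?thesis using cls_eqI[OF transport_rel[OF a K]] unfolding transport_def by metis
qed

lemma transport_cnb:
  assumes a: "is_aut V E s t \<phi> \<psi>" and K: "wk x0 K (\<phi> x0)" and nb: "cnb X Y"
  shows "cnb (transport K \<phi> \<psi> X) (transport K \<phi> \<psi> Y)"
proof -
  obtain W d where W: "wk x0 W (dstart s t d)" "fst d \<in> E" "X = cls W" "Y = cls (W @ [d])"
    using nb unfolding cnb_def by blast
  have w: "wk x0 (W @ [d]) (dend s t d)" using W(1) wk_dart[OF W(2)] by (rule wk_appendI)
  have "wk x0 (K @ map (dart_map s \<phi> \<psi>) W) (\<phi> (dstart s t d))" using K dart_map_walk[OF a W(1)] by (rule wk_appendI)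
  then have "cnb (cls (K @ map (dart_map s \<phi> \<psi>) W)) (cls ((K @ map (dart_map s \<phi> \<psi>) W) @ [dart_map s \<phi> \<psi> d]))"
    using dart_map_ends[OF a W(2)] by (intro cnbI) simp_all
  then show ?thesis using transport_cls[OF a K W(1)] transport_cls[OF a K w] W(3,4) by simp
qed

lemma transport_in:
  assumes a: "is_aut V E s t \<phi> \<psi>" and K: "wk x0 K (\<phi> x0)" and X: "X \<in> CV"
  shows "transport K \<phi> \<psi> X \<in> CV"
proof -
  obtain W y where W: "X = cls W" "wk x0 W y" using X by (rule CV_E)
  show ?thesis unfolding W(1) transport_cls[OF a K W(2)]
    using in_CV[OF wk_appendI[OF K dart_map_walk[OF a W(2)]]] .
qed

lemma transport_inverse:
  assumes a: "is_aut V E s t \<phi> \<psi>" "is_aut V E s t \<phi>' \<psi>'" and K: "wk x0 K (\<phi> x0)" "wk x0 K' (\<phi>' x0)"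
    and inv: "\<And>v. v \<in> V \<Longrightarrow> \<phi>' (\<phi> v) = v" "\<And>e. e \<in> E \<Longrightarrow> \<psi>' (\<psi> e) = e"
    and KK: "homotopic (K' @ map (dart_map s \<phi>' \<psi>') K) []"
    and X: "X \<in> CV"
  shows "transport K' \<phi>' \<psi>' (transport K \<phi> \<psi> X) = X"
proof -
  obtain W y where W: "X = cls W" "wk x0 W y" using X by (rule CV_E)
  have w: "wk x0 (K @ map (dart_map s \<phi> \<psi>) W) (\<phi> y)" using K(1) dart_map_walk[OF a(1) W(2)] by (rule wk_appendI)
  have w': "wk x0 (K' @ map (dart_map s \<phi>' \<psi>') (K @ map (dart_map s \<phi> \<psi>) W)) y"
    using wk_appendI[OF K(2) dart_map_walk[OF a(2) w]] inv(1) is_walk_end[OF W(2)] by simp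
  have "map (dart_map s \<phi>' \<psi>') (map (dart_map s \<phi> \<psi>) W) = W"
    by (rule map_dart_map_inverse[OF wf a(1) inv W(2)])
  then have "homotopic (K' @ map (dart_map s \<phi>' \<psi>') (K @ map (dart_map s \<phi> \<psi>) W)) W"
    using homotopic_context[OF KK, of "[]" W] by simp
  then have "cls (K' @ map (dart_map s \<phi>' \<psi>') (K @ map (dart_map s \<phi> \<psi>) W)) = cls W"
    using cls_eqI[OF rel_homotopic[OF w' W(2)]] by blast
  then show ?thesis using transport_cls[OF a(1) K(1) W(2)] transport_cls[OF a(2) K(2) w] W(1) by simp
qed

lemma transport_aut:
  assumes a: "is_aut V E s t \<phi> \<psi>" and K: "wk x0 K (\<phi> x0)"
  shows "cover.aut (transport K \<phi> \<psi>)"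
proof -
  define \<phi>' where "\<phi>' = inv_into V \<phi>"
  define \<psi>' where "\<psi>' = inv_into E \<psi>"
  \<comment> \<open>With this choice both \<open>K'\<close> followed by the
    \<open>\<phi>'\<close>-image of \<open>K\<close> and \<open>K\<close> followed by the
    \<open>\<phi>\<close>-image of \<open>K'\<close> are null-homotopic, so the two transports are
    mutually inverse.\<close>
  define K' where "K' = map (dart_map s \<phi>' \<psi>') (walk_rev K)"
  have a': "is_aut V E s t \<phi>' \<psi>'" unfolding \<phi>'_def \<psi>'_def by (rule is_aut_inv[OF wf a])
  have b: "bij_betw \<phi> V V" "bij_betw \<psi> E E" using a unfolding is_aut_def by auto
  have inv: "\<And>v. v \<in> V \<Longrightarrow> \<phi>' (\<phi> v) = v" "\<And>e. e \<in> E \<Longrightarrow> \<psi>' (\<psi> e) = e"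
    using b unfolding \<phi>'_def \<psi>'_def bij_betw_def by auto
  have inv': "\<And>v. v \<in> V \<Longrightarrow> \<phi> (\<phi>' v) = v" "\<And>e. e \<in> E \<Longrightarrow> \<psi> (\<psi>' e) = e"
    using b unfolding \<phi>'_def \<psi>'_def bij_betw_def by (auto simp: f_inv_into_f)
  have K': "wk x0 K' (\<phi>' x0)"
    using dart_map_walk[OF a' wk_rev[OF K]] inv(1)[OF x0] unfolding K'_def by simp
  have KK: "homotopic (K' @ map (dart_map s \<phi>' \<psi>') K) []"
    using homotopic_dart_map[OF homotopic_rev_Nil[of "walk_rev K"]] unfolding K'_def by fastforce
  have "map (dart_map s \<phi> \<psi>) K' = walk_rev K"
    unfolding K'_def by (rule map_dart_map_inverse[OF wf a' inv' wk_rev[OF K]])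
  then have KK': "homotopic (K @ map (dart_map s \<phi> \<psi>) K') []" using homotopic_rev_Nil by simp
  have i: "transport K' \<phi>' \<psi>' (transport K \<phi> \<psi> X) = X" if "X \<in> CV" for X
    by (rule transport_inverse[OF a a' K K' _ _ KK that]) (simp_all add: inv)
  have i': "transport K \<phi> \<psi> (transport K' \<phi>' \<psi>' X) = X" if "X \<in> CV" for X
    by (rule transport_inverse[OF a' a K' K _ _ KK' that]) (simp_all add: inv')
  have "bij_betw (transport K \<phi> \<psi>) CV CV"
    by (rule bij_betw_byWitness[where f' = "transport K' \<phi>' \<psi>'"])
      (use i i' transport_in[OF a K] transport_in[OF a' K'] in auto)
  moreover have "cnb (transport K \<phi> \<psi> X) (transport K \<phi> \<psi> Y) \<longleftrightarrow> cnb X Y" if "X \<in> CV" "Y \<in> CV" for X Y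
    using transport_cnb[OF a K] transport_cnb[OF a' K', of "transport K \<phi> \<psi> X" "transport K \<phi> \<psi> Y"] 
      i[OF that(1)] i[OF that(2)] by auto
  ultimately show ?thesis unfolding cover.aut_def by blast
qed

lemma cover_quasi_transitive:
  assumes qt: "quasi_transitive V E s t" and con: "connected_graph V E s t"
  shows "\<exists>R. finite R \<and> (\<forall>X\<in>CV. \<exists>g. cover.aut g \<and> g X \<in> R)"
proof -
  obtain Y where Y: "Y \<subseteq> V" "finite Y" "aut_orbit V E s t ` V = aut_orbit V E s t ` Y"
    using finite_subset_image[of "aut_orbit V E s t ` V" "aut_orbit V E s t" V] qt
    unfolding quasi_transitive_def by blast
  have "\<exists>W. wk x0 W y" if "y \<in> V" for y
    using con x0 that reach_avoid_walk[OF wf] unfolding connected_graph_def by blast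
  then obtain P where P: "\<And>y. y \<in> V \<Longrightarrow> wk x0 (P y) y" by metis
  have "\<exists>g. cover.aut g \<and> g X \<in> (\<lambda>y. cls (P y)) ` Y" if X: "X \<in> CV" for X
  proof -
    obtain W y where W: "X = cls W" "wk x0 W y" using X by (rule CV_E)
    have "aut_orbit V E s t y \<in> aut_orbit V E s t ` Y" using Y(3) is_walk_end[OF W(2)] by blast
    then obtain y' where y': "y' \<in> Y" "aut_orbit V E s t y = aut_orbit V E s t y'" by blast
    have "is_aut V E s t id id" unfolding is_aut_def by (auto simp: bij_betw_def)
    then have "y' \<in> aut_orbit V E s t y'" 
      unfolding aut_orbit_def by (intro CollectI exI[of _ id] conjI exI[of _ id]) simp_all
    then have "y' \<in> aut_orbit V E s t y" using y'(2) by simp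
    then obtain \<phi> \<psi> where a: "is_aut V E s t \<phi> \<psi>" "\<phi> y = y'"
      unfolding aut_orbit_def by blast
    \<comment> \<open>Chosen so that \<open>K\<close> followed by the image of \<open>W\<close> is
      homotopic to \<open>P y'\<close>: the lift takes \<open>X\<close> to the selected vertex over
      \<open>y'\<close>. Hence one vertex over each orbit representative suffices.\<close>
    define K where "K = P y' @ map (dart_map s \<phi> \<psi>) (walk_rev W)"
    have Py: "wk x0 (P y') y'" using P y'(1) Y(1) by blast
    have K: "wk x0 K (\<phi> x0)"
      unfolding K_def using dart_map_walk[OF a(1) wk_rev[OF W(2)]] a(2) by (intro wk_appendI[OF Py]) simp
    have w: "wk x0 (K @ map (dart_map s \<phi> \<psi>) W) y'"
      using wk_appendI[OF K dart_map_walk[OF a(1) W(2)]] a(2) by simp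
    have "homotopic (P y' @ map (dart_map s \<phi> \<psi>) (walk_rev W @ W) @ []) (P y' @ map (dart_map s \<phi> \<psi>) [] @ [])"
      by (intro homotopic_context homotopic_dart_map) (use homotopic_rev_Nil[of "walk_rev W"] in simp)
    then have "rel (K @ map (dart_map s \<phi> \<psi>) W) (P y')"
      using rel_homotopic[OF w Py] unfolding K_def by simp
    then have "transport K \<phi> \<psi> X = cls (P y')"
      using transport_cls[OF a(1) K W(2)] cls_eqI W(1) by simp
    then show ?thesis using transport_aut[OF a(1) K] y'(1) by blast
  qed
  then show ?thesis using Y(2) by (intro exI[of _ "(\<lambda>y. cls (P y)) ` Y"]) auto
qed

lemma cover_conn: "cover.conn CV"
  unfolding cover.conn_def
proof (intro allI impI, rule ccontr)
  fix S assume S: "S \<subseteq> CV" "S \<noteq> {}" "S \<noteq> CV" and no: "\<not> (\<exists>X\<in>S. \<exists>Y\<in>CV - S. cnb X Y)"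
  have "cls W \<in> S \<longleftrightarrow> cls [] \<in> S" if "wk x0 W y" for W y
    using that
  proof (induction W arbitrary: y rule: rev_induct)
    case (snoc d W)
    obtain z where z: "wk x0 W z" "wk z [d] y" using snoc.prems wk_append by blast
    have nb: "cnb (cls W) (cls (W @ [d]))" using cnbI[of W d] z by simp
    have "cls W \<in> S \<longleftrightarrow> cls (W @ [d]) \<in> S"
      using no nb cnb_sym[OF nb] cnb_in[OF nb] cnb_in[OF cnb_sym[OF nb]] by blast
    then show ?case using snoc.IH[OF z(1)] by simp
  qed simp
  then have "X \<in> S \<longleftrightarrow> cls [] \<in> S" if "X \<in> CV" for X using CV_E[OF that] by metis
  then show False using S by blast
qed

lemma cover_locally_finite:
  assumes "locally_finite V E s t" shows "finite {Y. cnb X Y}"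
proof (cases "X \<in> CV")
  case False
  then have "{Y. cnb X Y} = {}" using cnb_in by blast
  then show ?thesis by simp
next
  case True
  then obtain W y where W: "X = cls W" "wk x0 W y" by (rule CV_E)
  let ?D = "{e \<in> E. s e = y \<or> t e = y} \<times> (UNIV :: bool set)"
  have "{Y. cnb X Y} \<subseteq> (\<lambda>d. cls (W @ [d])) ` ?D"
  proof
    fix Y assume "Y \<in> {Y. cnb X Y}"
    then obtain W' d where W': "wk x0 W' (dstart s t d)" "fst d \<in> E" "X = cls W'" "Y = cls (W' @ [d])"
      unfolding cnb_def by blast
    have rel: "rel W' W" using cls_eq[OF W'(1), of W] W'(3) W(1) by simp
    then have y: "dstart s t d = y" using is_walk_unique[OF W(2)] is_walk_unique[OF W'(1)] unfolding rel_def by blast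
    then have "Y = cls (W @ [d])"
      using cls_eqI[OF rel_append[OF rel W'(1) wk_dart[OF W'(2)]]] W'(4) by simp
    moreover have "d \<in> ?D" using y W'(2) by (cases d) (auto simp: dstart_def split: if_splits)
    ultimately show "Y \<in> (\<lambda>d. cls (W @ [d])) ` ?D" by blast
  qed
  moreover have "finite ?D"
    using assms is_walk_end[OF W(2)] unfolding locally_finite_def by simp
  ultimately show ?thesis using finite_subset by blast
qed

end

section \<open>Accessibility of the local cover\<close>

theorem theorem6p2:
  fixes V :: "'v set" and E :: "'e set" and s t :: "'e \<Rightarrow> 'v" and x0 :: 'v and r :: nat
  assumes "wf_graph V E s t"
    and "connected_graph V E s t"
    and "locally_finite V E s t"
    and "quasi_transitive V E s t"
    and "x0 \<in> V"
    and "r > 0"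
  shows "accessible (cover_V V E s t x0 r) (cover_E V E s t x0 r) cover_src (cover_tgt V E s t x0 r)"
proof -
  interpret local_cover V E s t x0 r using assms(1,5) by unfold_locales
  obtain R where R: "finite R" "\<forall>X\<in>CV. \<exists>g. cover.aut g \<and> g X \<in> R"
    using cover_quasi_transitive[OF assms(4,2)] by blast
  \<comment> \<open>The maximum admits walks along an edge and back even for \<open>r = 1\<close>;
    allowing more short walks only strengthens the hypothesis under which \<open>coboundary\<close>
    must be shown.\<close>
  interpret short_cycle_graph CV cnb "max 2 r" R
  proof unfold_locales
    show "cover.conn CV" by (rule cover_conn)
    show "finite {v. cnb u v}" for u by (rule cover_locally_finite[OF assms(3)])
    show "2 \<le> max 2 r" by simp
    show "\<exists>S. \<forall>u v. cnb u v \<longrightarrow> ((u, v) \<in> P \<longleftrightarrow> (u \<in> S) \<noteq> (v \<in> S))"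
      if "sym P" "\<And>vs. cover.short_closed (max 2 r) vs \<Longrightarrow> \<not> crossing_parity P vs" for P
      using that by (rule cover_coboundary)
    show "finite R" by (rule R(1))
    show "\<exists>g. cover.aut g \<and> g x \<in> R" if "x \<in> CV" for x using R(2) that by blast
  qed
  show ?thesis
    by (rule accessible_of_finite_orders)
      (simp_all add: cover_adj finite_orders cover_locally_finite[OF assms(3)])
qed

end
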